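(* Consider the Gaussian non-random many-access channel in which, at blocklength $n$, there are $k_n$ users, all active with probability one, with noise variance $N_0/2$ per symbol. The capacity per unit-energy $\dot{C}^A$ for the average probability of error (APE) has the following behaviour: 1) If $k_n=o(n)$, then $\dot{C}^A=\frac{\log e}{N_0}$. Furthermore, the capacity per unit-energy can be achieved by an orthogonal-access scheme where each user uses an orthogonal codebook. 2) If $k_n=\Omega(n)$, then $\dot{C}^A=0$.
   Context: Logarithms $\log$ are to base 2. For nonnegative sequences: $a_n=o(b_n)$ means $\lim a_n/b_n=0$; $a_n=\Omega(b_n)$ means $\liminf a_n/b_n>0$. Channel. At blocklength $n$ there are $k_n$ users (a positive integer depending on $n$). User $i$ has a message $W_i$; the messages are independent and uniform on $\{1,\ldots,M_n\}$. User $i$ sends a codeword $\mathbf{x}_i(W_i)\in\mathbb{R}^n$ and the receiver observes $\mathbf{Y}=\sum_{i=1}^{k_n}\mathbf{x}_i(W_i)+\mathbf{Z}$, where $\mathbf{Z}$ has $n$ i.i.d. $\mathcal{N}(0,N_0/2)$ components, independent of the messages; $N_0>0$ is fixed. Codes for APE. A symmetric $(n,M_n,E_n,\epsilon)$ code for APE consists of encoding functions $w\mapsto\mathbf{x}_i(w)$, $i=1,\ldots,k_n$ (one codebook per user), with $\sum_{j=1}^n x_{ij}(w)^2\le E_n$ for all $w$, and a decoding function mapping $\mathbf{Y}$ to $(\hat W_1,\ldots,\hat W_{k_n})$ whose average probability of error satisfies $P_{e,A}^{(n)}=\frac{1}{k_n}\sum_{i=1}^{k_n}\Pr\{\hat W_i\ne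 W_i\}\le\epsilon$. A rate per unit-energy $\dot R$ is $\epsilon$-achievable if for every $\delta>0$ there exists $n_0$ such that for every $n\ge n_0$ there is an $(n,M_n,E_n,\epsilon)$ code for APE with $\frac{\log M_n}{E_n}>\dot R-\delta$. It is achievable if it is $\epsilon$-achievable for all $0<\epsilon<1$. $\dot C^A$ is the supremum of all achievable rates per unit-energy. A codebook of user $i$ is orthogonal if the inner product between $\mathbf{x}_i(w)$ and $\mathbf{x}_i(w')$ is zero for all $w\ne w'$ in $\{1,\ldots,M_n\}$. An access scheme is orthogonal if, for any two distinct users $i$ and $j$, the inner product between $\mathbf{x}_i(w)$ and $\mathbf{x}_j(w')$ is zero for all $w,w'\in\{1,\ldots,M_n\}$. *)

theory Defs
  imports "HOL-Probability.Probability" "HOL-Library.Landau_Symbols"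
begin

text \<open>
  Users are indexed by \<open>{1..K}\<close>, messages by \<open>{1..M}\<close> and channel uses by \<open>{1..n}\<close>. Since the
  blocklength varies, a vector in \<open>n\<close>-dimensional space is a function \<open>nat \<Rightarrow> real\<close> of which only
  the values on \<open>{1..n}\<close> matter. A family of codebooks \<open>x\<close> has type
  \<open>nat \<Rightarrow> nat \<Rightarrow> nat \<Rightarrow> real\<close>: \<open>x i w j\<close> is the \<open>j\<close>-th symbol sent by user \<open>i\<close> for message \<open>w\<close>.
\<close>

type_synonym codebook = "nat \<Rightarrow> nat \<Rightarrow> real"

definition message_space :: "nat \<Rightarrow> nat \<Rightarrow> (nat \<Rightarrow> nat) measure" where
  "message_space K M = PiM {1..K} (\<lambda>_. uniform_count_measure {1..M})"

text \<open>The second argument of \<^const>\<open>normal_density\<close> is the standard deviation.\<close>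

definition noise_space :: "real \<Rightarrow> nat \<Rightarrow> (nat \<Rightarrow> real) measure" where
  "noise_space N0 n = PiM {1..n} (\<lambda>_. density lborel (normal_density 0 (sqrt (N0 / 2))))"

definition mac_space :: "real \<Rightarrow> nat \<Rightarrow> nat \<Rightarrow> nat \<Rightarrow> ((nat \<Rightarrow> nat) \<times> (nat \<Rightarrow> real)) measure" where
  "mac_space N0 K n M = message_space K M \<Otimes>\<^sub>M noise_space N0 n"

definition channel_output ::
    "nat \<Rightarrow> nat \<Rightarrow> (nat \<Rightarrow> codebook) \<Rightarrow> (nat \<Rightarrow> nat) \<Rightarrow> (nat \<Rightarrow> real) \<Rightarrow> (nat \<Rightarrow> real)" where
  "channel_output K n x w z = (\<lambda>j\<in>{1..n}. (\<Sum>i=1..K. x i (w i) j) + z j)"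

definition user_error_prob ::
    "real \<Rightarrow> nat \<Rightarrow> nat \<Rightarrow> nat \<Rightarrow> (nat \<Rightarrow> codebook) \<Rightarrow> ((nat \<Rightarrow> real) \<Rightarrow> nat \<Rightarrow> nat) \<Rightarrow> nat \<Rightarrow> real" where
  "user_error_prob N0 K n M x dec i =
     \<P>(\<omega> in mac_space N0 K n M. dec (channel_output K n x (fst \<omega>) (snd \<omega>)) i \<noteq> fst \<omega> i)"

definition average_error_prob ::
    "real \<Rightarrow> nat \<Rightarrow> nat \<Rightarrow> nat \<Rightarrow> (nat \<Rightarrow> codebook) \<Rightarrow> ((nat \<Rightarrow> real) \<Rightarrow> nat \<Rightarrow> nat) \<Rightarrow> real" where
  "average_error_prob N0 K n M x dec = (1 / real K) * (\<Sum>i=1..K. user_error_prob N0 K n M x dec i)"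

text \<open>
  Decoders are measurable, so that the error events have a probability. The energy \<open>E\<close> is
  positive, so that the quotient in the rate per unit-energy is never a division by zero.
\<close>

definition ape_code ::
    "real \<Rightarrow> nat \<Rightarrow> nat \<Rightarrow> nat \<Rightarrow> real \<Rightarrow> real \<Rightarrow> (nat \<Rightarrow> codebook) \<Rightarrow>
     ((nat \<Rightarrow> real) \<Rightarrow> nat \<Rightarrow> nat) \<Rightarrow> bool" where
  "ape_code N0 K n M E \<epsilon> x dec \<longleftrightarrow>
     M \<ge> 1 \<and> E > 0 \<and>
     (\<forall>i\<in>{1..K}. \<forall>w\<in>{1..M}. (\<Sum>j=1..n. (x i w j)\<^sup>2) \<le> E) \<and>
     dec \<in> measurable (PiM {1..n} (\<lambda>_. borel)) (PiM {1..K} (\<lambda>_. count_space {1..M})) \<and>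
     average_error_prob N0 K n M x dec \<le> \<epsilon>"

definition dot :: "nat \<Rightarrow> (nat \<Rightarrow> real) \<Rightarrow> (nat \<Rightarrow> real) \<Rightarrow> real" where
  "dot n u v = (\<Sum>j=1..n. u j * v j)"

definition orthogonal_codebook :: "nat \<Rightarrow> nat \<Rightarrow> codebook \<Rightarrow> bool" where
  "orthogonal_codebook n M c \<longleftrightarrow>
     (\<forall>w\<in>{1..M}. \<forall>w'\<in>{1..M}. w \<noteq> w' \<longrightarrow> dot n (c w) (c w') = 0)"

definition orthogonal_access :: "nat \<Rightarrow> nat \<Rightarrow> nat \<Rightarrow> (nat \<Rightarrow> codebook) \<Rightarrow> bool" where
  "orthogonal_access K n M x \<longleftrightarrow>
     (\<forall>i\<in>{1..K}. \<forall>j\<in>{1..K}. i \<noteq> j \<longrightarrow>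
        (\<forall>w\<in>{1..M}. \<forall>w'\<in>{1..M}. dot n (x i w) (x j w') = 0))"

text \<open>
  Achievability is parametrised by the class \<open>S\<close> of admissible codebook families, with \<open>S K n M x\<close>
  stating that \<open>x\<close> is admissible for \<open>K\<close> users, blocklength \<open>n\<close> and \<open>M\<close> messages per user.
\<close>

type_synonym scheme_class = "nat \<Rightarrow> nat \<Rightarrow> nat \<Rightarrow> (nat \<Rightarrow> codebook) \<Rightarrow> bool"

definition any_scheme :: scheme_class where
  "any_scheme K n M x \<longleftrightarrow> True"

definition orthogonal_scheme :: scheme_class where
  "orthogonal_scheme K n M x \<longleftrightarrow>
     orthogonal_access K n M x \<and> (\<forall>i\<in>{1..K}. orthogonal_codebook n M (x i))"

definition eps_achievable_by ::
    "scheme_class \<Rightarrow> (nat \<Rightarrow> nat) \<Rightarrow> real \<Rightarrow> real \<Rightarrow> real \<Rightarrow> bool" where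
  "eps_achievable_by S k N0 \<epsilon> R \<longleftrightarrow>
     (\<forall>\<delta>>0. \<exists>n0. \<forall>n\<ge>n0. \<exists>M E x dec.
        ape_code N0 (k n) n M E \<epsilon> x dec \<and> S (k n) n M x \<and> log 2 (real M) / E > R - \<delta>)"

definition achievable_by :: "scheme_class \<Rightarrow> (nat \<Rightarrow> nat) \<Rightarrow> real \<Rightarrow> real \<Rightarrow> bool" where
  "achievable_by S k N0 R \<longleftrightarrow> (\<forall>\<epsilon>. 0 < \<epsilon> \<and> \<epsilon> < 1 \<longrightarrow> eps_achievable_by S k N0 \<epsilon> R)"

text \<open>
  The supremum is taken in the extended reals, so that a finite value of the capacity includes
  the claim that the achievable rates are bounded above.
\<close>

definition capacity_APE :: "(nat \<Rightarrow> nat) \<Rightarrow> real \<Rightarrow> ereal" where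
  "capacity_APE k N0 = Sup (ereal ` {R. achievable_by any_scheme k N0 R})"

end

theory Submission
  imports Defs
begin

text \<open>
  Both converses rest on \<open>E\<^sub>P f \<le> D(P \<parallel> Q) + E\<^sub>Q (exp f) - 1\<close> for Gaussian \<open>P\<close> and \<open>Q\<close>. Taking for
  \<open>f\<close> a multiple of the number of correctly decoded messages and for \<open>Q\<close> the Gaussian law with
  the mean and the average variance of the output gives
  \<open>(1 - \<epsilon>) ln M \<le> ln 2 + n / (2 K) * ln (1 + 2 K E / (n N0))\<close>. If the rate stays above \<open>1 / (N0 ln 2)\<close>,
  or above \<open>0\<close> when \<open>K\<close> is at least of order \<open>n\<close>, this bounds \<open>E\<close> uniformly for small \<open>\<epsilon>\<close>. Comparing
  instead the outputs for two messages of one user shows that \<open>E\<close> must tend to infinity as \<open>\<epsilon>\<close>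
  tends to \<open>0\<close>, as soon as \<open>M \<ge> 2\<close>, which is a contradiction.

  Conversely, if \<open>K = o(n)\<close>, every user gets an arbitrarily large number \<open>M\<close> of private channel uses
  and can signal by the position of a single pulse of energy slightly above \<open>N0 ln M\<close>, which a
  threshold test detects with error probability tending to \<open>0\<close> as \<open>M\<close> grows. So a fixed \<open>M\<close>
  suffices for given \<open>\<epsilon>\<close> and \<open>\<delta>\<close>.
\<close>

subsection \<open>Change of measure between Gaussian vectors\<close>

text \<open>The inequality \<open>1 + u <= exp u\<close> at \<open>u = f - ln r\<close> is
  integrated against \<open>P\<close>; the quotient \<open>exp f / r\<close> integrates under
  \<open>P\<close> to what \<open>exp f\<close> gives under \<open>Q\<close>. The integral of
  \<open>ln r\<close> is the divergence of \<open>P\<close> from \<open>Q\<close>. The bound is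
  linear in the integral of \<open>exp f\<close>, so it can be summed over message tuples.\<close>

lemma change_of_measure_le:
  fixes f r :: "'a \<Rightarrow> real"
  assumes "prob_space P" and "prob_space Q"
    and P: "P = density Q (\<lambda>x. ennreal (r x))"
    and r [measurable]: "r \<in> borel_measurable Q"
    and r_pos: "\<And>x. r x > 0"
    and int_ln: "integrable P (\<lambda>x. ln (r x))"
    and f [measurable]: "f \<in> borel_measurable Q"
    and bounded: "\<And>x. \<bar>f x\<bar> \<le> B"
  shows "(\<integral>x. f x \<partial>P) \<le> (\<integral>x. ln (r x) \<partial>P) + (\<integral>x. exp (f x) \<partial>Q) - 1"
proof -
  interpret P: prob_space P by fact
  interpret Q: prob_space Q by fact
  have sets_P [measurable_cong]: "sets P = sets Q"
    by (simp add: P)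
  have int_exp: "integrable Q (\<lambda>x. exp (f x))"
    by (rule Q.integrable_const_bound[where B = "exp B"])
       (use bounded in \<open>auto simp: abs_le_iff\<close>)
  have int_f: "integrable P f"
    by (rule P.integrable_const_bound[where B = B]) (use bounded in \<open>auto simp: P\<close>)
  have r_nz [simp]: "r x \<noteq> 0" for x
    using r_pos[of x] by simp
  have int_quot: "integrable P (\<lambda>x. exp (f x) / r x)"
    unfolding P by (subst integrable_density) (use int_exp r_pos in \<open>auto simp: less_imp_le\<close>)
  have "(\<integral>x. exp (f x) / r x \<partial>P) = (\<integral>x. exp (f x) \<partial>Q)"
    unfolding P by (subst integral_density) (use r_pos in \<open>auto simp: less_imp_le\<close>)
  moreover have "(\<integral>x. f x \<partial>P) \<le> (\<integral>x. ln (r x) + exp (f x) / r x - 1 \<partial>P)"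
  proof (rule integral_mono)
    show "f x \<le> ln (r x) + exp (f x) / r x - 1" for x
      using exp_ge_add_one_self[of "f x - ln (r x)"] r_pos[of x] by (simp add: exp_diff)
  qed (use int_f int_ln int_quot in auto)
  ultimately show ?thesis
    using int_ln int_quot by (simp add: P.prob_space)
qed

section \<open>Product Gaussian laws: densities, moments and divergence\<close>

definition gaussian :: "nat \<Rightarrow> (nat \<Rightarrow> real) \<Rightarrow> real \<Rightarrow> (nat \<Rightarrow> real) measure" where
  "gaussian n m s = PiM {1..n} (\<lambda>j. density lborel (normal_density (m j) s))"

lemma sets_gaussian [measurable_cong]: "sets (gaussian n m s) = sets (PiM {1..n} (\<lambda>_. borel))"
  unfolding gaussian_def by (rule sets_PiM_cong) auto

lemma space_gaussian: "space (gaussian n m s) = PiE {1..n} (\<lambda>_. UNIV)"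
  by (simp add: gaussian_def space_PiM)

lemma prob_space_gaussian: "s > 0 \<Longrightarrow> prob_space (gaussian n m s)"
  unfolding gaussian_def by (intro prob_space_PiM prob_space_normal_density)

lemma density_normal_ratio:
  assumes "s > 0" "t > 0"
  shows "density lborel (normal_density a s) =
    density (density lborel (normal_density b t)) (\<lambda>y. ennreal (normal_density a s y / normal_density b t y))"
  using assms normal_density_pos[OF assms(2), of b]
  by (subst density_density_eq)
     (auto intro!: density_cong simp: ennreal_mult'[symmetric] less_imp_neq[symmetric])

text \<open>A finite product measure is determined by its values on boxes, and on a box the integral
  of the product of the coordinate ratios factors into one-dimensional integrals.\<close>

lemma gaussian_eq_density:
  assumes "s > 0" "t > 0"
  shows "gaussian n a s = density (gaussian n b t)
    (\<lambda>y. ennreal (\<Prod>j=1..n. normal_density (a j) s (y j) / normal_density (b j) t (y j)))"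
proof -
  let ?q = "\<lambda>j. density lborel (normal_density (b j) t)"
  let ?p = "\<lambda>j. density lborel (normal_density (a j) s)"
  let ?r = "\<lambda>j y. normal_density (a j) s y / normal_density (b j) t y"
  have r_nonneg: "0 \<le> ?r j y" for j y
    by simp
  interpret q: product_sigma_finite ?q
    by (intro product_sigma_finite.intro prob_space_imp_sigma_finite prob_space_normal_density assms)
  interpret p: product_sigma_finite ?p
    by (intro product_sigma_finite.intro prob_space_imp_sigma_finite prob_space_normal_density assms)
  have "density (gaussian n b t) (\<lambda>y. ennreal (\<Prod>j=1..n. ?r j (y j))) = PiM {1..n} ?p"
  proof (rule p.PiM_eqI)
    show "sets (density (gaussian n b t) (\<lambda>y. ennreal (\<Prod>j=1..n. ?r j (y j)))) = sets (PiM {1..n} ?p)"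
      unfolding sets_density sets_gaussian by (rule sets_PiM_cong) auto
    fix A :: "nat \<Rightarrow> real set" assume A: "\<And>j. j \<in> {1..n} \<Longrightarrow> A j \<in> sets (?p j)"
    have PiE_A: "PiE {1..n} A \<in> sets (gaussian n b t)"
      unfolding gaussian_def by (rule sets_PiM_I_finite) (use A in auto)
    have "emeasure (density (gaussian n b t) (\<lambda>y. ennreal (\<Prod>j=1..n. ?r j (y j)))) (PiE {1..n} A)
      = (\<integral>\<^sup>+ y. ennreal (\<Prod>j=1..n. ?r j (y j)) * indicator (PiE {1..n} A) y \<partial>gaussian n b t)"
      by (rule emeasure_density) (use PiE_A in measurable)
    also have "\<dots> = (\<integral>\<^sup>+ y. (\<Prod>j=1..n. ennreal (?r j (y j)) * indicator (A j) (y j)) \<partial>gaussian n b t)"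
    proof (rule nn_integral_cong)
      fix y assume "y \<in> space (gaussian n b t)"
      then have ext: "y \<in> extensional {1..n}"
        by (auto simp: space_gaussian PiE_def)
      \<comment> \<open>Membership in the box also demands extensionality, which every point of the
        space has; hence the indicator factors over the coordinates.\<close>
      have "indicator (PiE {1..n} A) y = (\<Prod>j=1..n. indicator (A j) (y j) :: ennreal)"
      proof (cases "y \<in> PiE {1..n} A")
        case True
        then show ?thesis by (auto simp: PiE_def Pi_def intro!: prod.neutral[symmetric])
      next
        case False
        then obtain j where "j \<in> {1..n}" "y j \<notin> A j"
          using ext by (auto simp: PiE_def Pi_def)
        then show ?thesis using False by (auto intro!: prod_zero[symmetric] bexI[of _ j])
      qed
      then show "ennreal (\<Prod>j=1..n. ?r j (y j)) * indicator (PiE {1..n} A) y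
          = (\<Prod>j=1..n. ennreal (?r j (y j)) * indicator (A j) (y j))"
        by (simp add: prod.distrib prod_ennreal)
    qed
    also have "\<dots> = (\<Prod>j=1..n. \<integral>\<^sup>+ y. ennreal (?r j y) * indicator (A j) y \<partial>?q j)"
      unfolding gaussian_def by (rule q.product_nn_integral_prod) (use A in auto)
    also have "\<dots> = (\<Prod>j=1..n. emeasure (?p j) (A j))"
      by (intro prod.cong refl, subst density_normal_ratio[OF assms, of "a _" "b _"])
        (use A in \<open>auto intro!: emeasure_density[symmetric]\<close>)
    finally show "emeasure (density (gaussian n b t) (\<lambda>y. ennreal (\<Prod>j=1..n. ?r j (y j)))) (PiE {1..n} A)
      = (\<Prod>j=1..n. emeasure (?p j) (A j))" .
  qed simp
  then show ?thesis
    by (simp add: gaussian_def)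
qed

lemma distr_gaussian_component:
  assumes "s > 0" "j \<in> {1..n}"
  shows "distr (gaussian n m s) (density lborel (normal_density (m j) s)) (\<lambda>y. y j)
    = density lborel (normal_density (m j) s)"
  unfolding gaussian_def
  by (rule distr_PiM_component[of _ "\<lambda>j. density lborel (normal_density (m j) s)"])
     (use assms in \<open>auto intro: prob_space_normal_density\<close>)

lemma has_bochner_integral_gaussian_component:
  fixes g :: "real \<Rightarrow> real"
  assumes "s > 0" "j \<in> {1..n}" and [measurable]: "g \<in> borel_measurable borel"
    and "has_bochner_integral lborel (\<lambda>y. normal_density (m j) s y * g y) I"
  shows "has_bochner_integral (gaussian n m s) (\<lambda>y. g (y j)) I"
proof -
  let ?N = "density lborel (normal_density (m j) s)"
  have "has_bochner_integral ?N g I"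
    using assms by (intro has_bochner_integral_density) auto
  then have g_distr: "has_bochner_integral (distr (gaussian n m s) ?N (\<lambda>y. y j)) g I"
    by (simp add: distr_gaussian_component[OF assms(1,2)])
  have component: "(\<lambda>y. y j) \<in> measurable (gaussian n m s) ?N"
    unfolding gaussian_def by (rule measurable_component_singleton) fact
  have "g \<in> borel_measurable ?N"
    by simp
  from integrable_distr_eq[OF component this] integral_distr[OF component this] g_distr
  show ?thesis
    by (simp only: has_bochner_integral_iff)
qed

text \<open>Writing \<open>y j - c\<close> as \<open>(y j - m j) + (m j - c)\<close> reduces the
  claim to the central moments of order 0, 1 and 2.\<close>

lemma has_bochner_integral_gaussian_square:
  assumes "s > 0" "j \<in> {1..n}"
  shows "has_bochner_integral (gaussian n m s) (\<lambda>y. (y j - c)\<^sup>2) (s\<^sup>2 + (m j - c)\<^sup>2)"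
proof (rule has_bochner_integral_gaussian_component)
  let ?p = "normal_density (m j) s"
  have 2: "has_bochner_integral lborel (\<lambda>y. ?p y * (y - m j)\<^sup>2) (s\<^sup>2)"
    using normal_moment_even[of s "m j" 1] assms by simp
  have 1: "has_bochner_integral lborel (\<lambda>y. ?p y * (y - m j)) 0"
    using normal_moment_odd[of s "m j" 0] assms by simp
  have 0: "has_bochner_integral lborel ?p 1"
    using normal_moment_even[of s "m j" 0] assms by simp
  have "has_bochner_integral lborel (\<lambda>y. ?p y * (y - m j)\<^sup>2 + (2 * (m j - c)) * (?p y * (y - m j)) + (m j - c)\<^sup>2 * ?p y)
          (s\<^sup>2 + (2 * (m j - c)) * 0 + (m j - c)\<^sup>2 * 1)"
    by (intro has_bochner_integral_add has_bochner_integral_mult_right 0 1 2)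
  moreover have "?p y * (y - m j)\<^sup>2 + (2 * (m j - c)) * (?p y * (y - m j)) + (m j - c)\<^sup>2 * ?p y
      = ?p y * (y - c)\<^sup>2" for y
    by (simp add: power2_eq_square algebra_simps)
  ultimately show "has_bochner_integral lborel (\<lambda>y. ?p y * (y - c)\<^sup>2) (s\<^sup>2 + (m j - c)\<^sup>2)"
    by simp
qed (use assms in auto)

lemma ln_normal_density_ratio:
  assumes "s > 0" "t > 0"
  shows "ln (normal_density a s y / normal_density b t y) =
    ln (t / s) + (y - b)\<^sup>2 / (2 * t\<^sup>2) - (y - a)\<^sup>2 / (2 * s\<^sup>2)"
proof -
  have "sqrt (2 * pi * s\<^sup>2) = sqrt (2 * pi) * s" "sqrt (2 * pi * t\<^sup>2) = sqrt (2 * pi) * t"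
    using assms by (simp_all add: real_sqrt_mult)
  moreover have "exp ((y - b)\<^sup>2 / (2 * t\<^sup>2) - (y - a)\<^sup>2 / (2 * s\<^sup>2)) =
      exp (- (y - a)\<^sup>2 / (2 * s\<^sup>2)) / exp (- (y - b)\<^sup>2 / (2 * t\<^sup>2))"
    by (simp add: exp_diff[symmetric])
  ultimately have "normal_density a s y / normal_density b t y =
      (t / s) * exp ((y - b)\<^sup>2 / (2 * t\<^sup>2) - (y - a)\<^sup>2 / (2 * s\<^sup>2))"
    using assms by (simp add: normal_density_def)
  then show ?thesis
    using assms by (simp add: ln_mult ln_div)
qed

text \<open>The value is the Kullback-Leibler divergence in nats. The normalising constants give
  \<open>ln (t / s)\<close>, and the squared deviations from \<open>b j\<close> and
  \<open>a j\<close> have means \<open>s^2 + (a j - b j)^2\<close> and \<open>s^2\<close>.\<close>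

lemma has_bochner_integral_gaussian_log_ratio:
  assumes "s > 0" "t > 0"
  shows "has_bochner_integral (gaussian n a s)
    (\<lambda>y. ln (\<Prod>j=1..n. normal_density (a j) s (y j) / normal_density (b j) t (y j)))
    (real n * (ln (t / s) + s\<^sup>2 / (2 * t\<^sup>2) - 1 / 2) + (\<Sum>j=1..n. (a j - b j)\<^sup>2) / (2 * t\<^sup>2))"
proof -
  interpret prob_space "gaussian n a s" by (rule prob_space_gaussian) fact
  have "has_bochner_integral (gaussian n a s)
      (\<lambda>y. \<Sum>j=1..n. ln (t / s) + (y j - b j)\<^sup>2 / (2 * t\<^sup>2) - (y j - a j)\<^sup>2 / (2 * s\<^sup>2))
      (\<Sum>j=1..n. ln (t / s) + (s\<^sup>2 + (a j - b j)\<^sup>2) / (2 * t\<^sup>2) - (s\<^sup>2 + (a j - a j)\<^sup>2) / (2 * s\<^sup>2))"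
  proof (intro has_bochner_integral_sum has_bochner_integral_diff has_bochner_integral_add
      has_bochner_integral_divide_zero has_bochner_integral_gaussian_square assms)
    show "has_bochner_integral (gaussian n a s) (\<lambda>y. ln (t / s)) (ln (t / s))"
      using has_bochner_integral_integrable[of "gaussian n a s" "\<lambda>_. ln (t / s)"]
      by (simp add: prob_space)
  qed
  moreover have "ln (\<Prod>j=1..n. normal_density (a j) s (y j) / normal_density (b j) t (y j)) =
      (\<Sum>j=1..n. ln (t / s) + (y j - b j)\<^sup>2 / (2 * t\<^sup>2) - (y j - a j)\<^sup>2 / (2 * s\<^sup>2))" for y
    using assms less_imp_neq[OF normal_density_pos[OF assms(1)]] less_imp_neq[OF normal_density_pos[OF assms(2)]]
    by (subst ln_prod) (auto simp: ln_normal_density_ratio normal_density_pos)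
  moreover have "(\<Sum>j=1..n. ln (t / s) + (s\<^sup>2 + (a j - b j)\<^sup>2) / (2 * t\<^sup>2) - (s\<^sup>2 + (a j - a j)\<^sup>2) / (2 * s\<^sup>2))
     = real n * (ln (t / s) + s\<^sup>2 / (2 * t\<^sup>2) - 1 / 2) + (\<Sum>j=1..n. (a j - b j)\<^sup>2) / (2 * t\<^sup>2)"
    using assms by (simp add: sum.distrib sum_subtractf sum_divide_distrib add_divide_distrib algebra_simps)
  ultimately show ?thesis by simp
qed

text \<open>Both converses use the change of measure in this form. For \<open>t = s\<close> the
  divergence reduces to the scaled squared distance of the means.\<close>

lemma gaussian_change_of_measure:
  assumes "s > 0" "t > 0"
    and "f \<in> borel_measurable (PiM {1..n} (\<lambda>_. borel))" and "\<And>y. \<bar>f y\<bar> \<le> B"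
  shows "(\<integral>y. f y \<partial>gaussian n a s) \<le>
    real n * (ln (t / s) + s\<^sup>2 / (2 * t\<^sup>2) - 1 / 2) + (\<Sum>j=1..n. (a j - b j)\<^sup>2) / (2 * t\<^sup>2)
    + (\<integral>y. exp (f y) \<partial>gaussian n b t) - 1"
proof -
  let ?r = "\<lambda>y. \<Prod>j=1..n. normal_density (a j) s (y j) / normal_density (b j) t (y j)"
  note KL = has_bochner_integral_gaussian_log_ratio[OF assms(1,2), of n a b]
  have "(\<integral>y. f y \<partial>gaussian n a s) \<le>
      (\<integral>y. ln (?r y) \<partial>gaussian n a s) + (\<integral>y. exp (f y) \<partial>gaussian n b t) - 1"
  proof (rule change_of_measure_le)
    show "gaussian n a s = density (gaussian n b t) (\<lambda>y. ennreal (?r y))"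
      by (rule gaussian_eq_density) fact+
    show "?r y > 0" for y
      using assms by (intro prod_pos divide_pos_pos ballI normal_density_pos)
    show "integrable (gaussian n a s) (\<lambda>y. ln (?r y))"
      using KL by (rule integrable.intros)
    show "f \<in> borel_measurable (gaussian n b t)"
      using assms(3) by (simp add: measurable_cong_sets[OF sets_gaussian refl])
    show "?r \<in> borel_measurable (gaussian n b t)"
      by measurable
  qed (use assms prob_space_gaussian in auto)
  then show ?thesis
    using has_bochner_integral_integral_eq[OF KL] by simp
qed

subsection \<open>The error probability as an average over messages\<close>

definition messages :: "nat \<Rightarrow> nat \<Rightarrow> (nat \<Rightarrow> nat) set" where
  "messages K M = PiE {1..K} (\<lambda>_. {1..M})"

lemma finite_messages [simp]: "finite (messages K M)"
  by (simp add: messages_def finite_PiE)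

lemma card_messages: "card (messages K M) = M ^ K"
  by (simp add: messages_def card_PiE)

lemma messages_mem: "w \<in> messages K M \<Longrightarrow> i \<in> {1..K} \<Longrightarrow> w i \<in> {1..M}"
  unfolding messages_def by (rule PiE_mem)

definition superposition :: "nat \<Rightarrow> (nat \<Rightarrow> codebook) \<Rightarrow> (nat \<Rightarrow> nat) \<Rightarrow> nat \<Rightarrow> real" where
  "superposition K x w j = (\<Sum>i=1..K. x i (w i) j)"

text \<open>The sent message enters only as the value \<open>v\<close>, so this is a set of outputs,
  and the conditional error probability given a message tuple is its Gaussian mass.\<close>

definition error_set :: "nat \<Rightarrow> ((nat \<Rightarrow> real) \<Rightarrow> nat \<Rightarrow> nat) \<Rightarrow> nat \<Rightarrow> nat \<Rightarrow> (nat \<Rightarrow> real) set" where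
  "error_set n dec i v = {y \<in> PiE {1..n} (\<lambda>_. UNIV). dec y i \<noteq> v}"

text \<open>Both measures live on a finite set, so agreement on singletons suffices; a singleton is
  a box of mass \<open>(1 / M) ^ K\<close>.\<close>

lemma message_space_eq:
  assumes "M \<ge> 1"
  shows "message_space K M = uniform_count_measure (messages K M)"
proof (rule measure_eqI_finite)
  have "sets (message_space K M) = sets (PiM {1..K} (\<lambda>_. count_space {1..M}))"
    unfolding message_space_def
    by (rule sets_PiM_cong) (auto simp: sets_uniform_count_measure)
  also have "\<dots> = Pow (messages K M)"
    by (subst count_space_PiM_finite) (auto simp: messages_def)
  finally show "sets (message_space K M) = Pow (messages K M)" .
  show "sets (uniform_count_measure (messages K M)) = Pow (messages K M)"
    by (simp add: sets_uniform_count_measure)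
  fix w assume w: "w \<in> messages K M"
  interpret product_sigma_finite "\<lambda>_::nat. uniform_count_measure {1..M}"
    by (intro product_sigma_finite.intro prob_space_imp_sigma_finite prob_space_uniform_count_measure)
       (use assms in auto)
  have "{w} = PiE {1..K} (\<lambda>i. {w i})"
    using w by (intro PiE_singleton[symmetric]) (simp add: messages_def PiE_def)
  then have "emeasure (message_space K M) {w} = (\<Prod>i=1..K. emeasure (uniform_count_measure {1..M}) {w i})"
    unfolding message_space_def
    using emeasure_PiM[of "{1..K}" "\<lambda>i. {w i}"] messages_mem[OF w]
    by (simp add: sets_uniform_count_measure)
  also have "\<dots> = (\<Prod>i=1..K. ennreal (1 / real M))"
    using messages_mem[OF w] by (intro prod.cong refl) (simp add: emeasure_uniform_count_measure)
  also have "\<dots> = ennreal (1 / real (M ^ K))"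
    by (simp add: ennreal_power power_one_over)
  also have "\<dots> = emeasure (uniform_count_measure (messages K M)) {w}"
    using w by (simp add: emeasure_uniform_count_measure card_messages)
  finally show "emeasure (message_space K M) {w} = emeasure (uniform_count_measure (messages K M)) {w}" .
qed simp

lemma noise_space_eq: "noise_space N0 n = gaussian n (\<lambda>_. 0) (sqrt (N0 / 2))"
  by (simp add: noise_space_def gaussian_def)

lemma distr_normal_translate:
  assumes "s > 0"
  shows "distr (density lborel (normal_density 0 s)) lborel (\<lambda>z. a + z) = density lborel (normal_density a s)"
proof -
  interpret prob_space "density lborel (normal_density 0 s)"
    by (rule prob_space_normal_density) fact
  have "distributed (density lborel (normal_density 0 s)) lborel (\<lambda>z. z) (normal_density 0 s)"
    by (simp add: distributed_def distr_id2)
  then have "distributed (density lborel (normal_density 0 s)) lborel (\<lambda>z. a + 1 * z)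
      (normal_density (a + 1 * 0) (\<bar>1\<bar> * s))"
    by (rule normal_density_affine) (use assms in auto)
  then show ?thesis
    using distributed_distr_eq_density by fastforce
qed

text \<open>A translation pulls boxes back to boxes, so the one-dimensional shift applies
  coordinatewise. With the superposed codewords as \<open>a\<close>, this is the law of the output
  given the messages.\<close>

lemma distr_gaussian_translate:
  assumes "s > 0"
  shows "distr (gaussian n (\<lambda>_. 0) s) (PiM {1..n} (\<lambda>_. borel)) (\<lambda>z. \<lambda>j\<in>{1..n}. a j + z j) = gaussian n a s"
proof -
  let ?N = "\<lambda>j. density lborel (normal_density (a j) s)"
  let ?Z = "\<lambda>j::nat. density lborel (normal_density 0 s)"
  let ?T = "\<lambda>z. \<lambda>j\<in>{1..n}. a j + z j"
  interpret N: product_sigma_finite ?N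
    by (intro product_sigma_finite.intro prob_space_imp_sigma_finite prob_space_normal_density assms)
  interpret Z: product_sigma_finite ?Z
    by (intro product_sigma_finite.intro prob_space_imp_sigma_finite prob_space_normal_density assms)
  have T [measurable]: "?T \<in> measurable (gaussian n (\<lambda>_. 0) s) (PiM {1..n} (\<lambda>_. borel))"
    by measurable
  have "distr (gaussian n (\<lambda>_. 0) s) (PiM {1..n} (\<lambda>_. borel)) ?T = PiM {1..n} ?N"
  proof (rule N.PiM_eqI)
    show "sets (distr (gaussian n (\<lambda>_. 0) s) (PiM {1..n} (\<lambda>_. borel)) ?T) = sets (PiM {1..n} ?N)"
      unfolding sets_distr by (rule sets_PiM_cong) auto
    fix A assume A: "\<And>j. j \<in> {1..n} \<Longrightarrow> A j \<in> sets (?N j)"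
    have A': "(\<lambda>z. a j + z) -` A j \<in> sets borel" if "j \<in> {1..n}" for j
      using A[OF that] measurable_sets[of "\<lambda>z. a j + z" borel borel "A j"] by simp
    have "emeasure (distr (gaussian n (\<lambda>_. 0) s) (PiM {1..n} (\<lambda>_. borel)) ?T) (PiE {1..n} A)
        = emeasure (gaussian n (\<lambda>_. 0) s) (?T -` PiE {1..n} A \<inter> space (gaussian n (\<lambda>_. 0) s))"
      by (rule emeasure_distr[OF T], rule sets_PiM_I_finite) (use A in auto)
    also have "?T -` PiE {1..n} A \<inter> space (gaussian n (\<lambda>_. 0) s) = PiE {1..n} (\<lambda>j. (\<lambda>z. a j + z) -` A j)"
      by (auto simp: space_gaussian PiE_def Pi_def)
    also have "emeasure (gaussian n (\<lambda>_. 0) s) \<dots> = (\<Prod>j=1..n. emeasure (?Z j) ((\<lambda>z. a j + z) -` A j))"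
      unfolding gaussian_def by (rule Z.emeasure_PiM) (use A' in auto)
    also have "\<dots> = (\<Prod>j=1..n. emeasure (?N j) (A j))"
    proof (intro prod.cong refl)
      fix j assume "j \<in> {1..n}"
      then show "emeasure (?Z j) ((\<lambda>z. a j + z) -` A j) = emeasure (?N j) (A j)"
        using A[of j] by (subst distr_normal_translate[OF assms, symmetric]) (simp add: emeasure_distr)
    qed
    finally show "emeasure (distr (gaussian n (\<lambda>_. 0) s) (PiM {1..n} (\<lambda>_. borel)) ?T) (PiE {1..n} A)
      = (\<Prod>j=1..n. emeasure (?N j) (A j))" .
  qed simp
  then show ?thesis
    by (simp add: gaussian_def)
qed

lemma channel_output_eq: "channel_output K n x w z = (\<lambda>j\<in>{1..n}. superposition K x w j + z j)"
  by (simp add: channel_output_def superposition_def)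

text \<open>Decoded values lie in \<open>{1..M}\<close>, so the set is the preimage of
  \<open>{1..M} - {v}\<close> under one coordinate of the decoder.\<close>

lemma error_set_measurable:
  assumes "dec \<in> measurable (PiM {1..n} (\<lambda>_. borel)) (PiM {1..K} (\<lambda>_. count_space {1..M}))"
    and "i \<in> {1..K}"
  shows "error_set n dec i v \<in> sets (PiM {1..n} (\<lambda>_. borel))"
proof -
  have "(\<lambda>y. dec y i) \<in> measurable (PiM {1..n} (\<lambda>_. borel)) (count_space {1..M})"
    using measurable_compose[OF assms(1) measurable_component_singleton[OF assms(2)]] .
  then have "(\<lambda>y. dec y i) -` ({1..M} - {v}) \<inter> space (PiM {1..n} (\<lambda>_. borel)) \<in> sets (PiM {1..n} (\<lambda>_. borel))"
    by (rule measurable_sets) simp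
  moreover have "(\<lambda>y. dec y i) -` ({1..M} - {v}) \<inter> space (PiM {1..n} (\<lambda>_. borel)) = error_set n dec i v"
    using measurable_space[OF assms(1)] PiE_mem[OF _ assms(2), of _ "\<lambda>_. {1..M}"]
    by (fastforce simp: error_set_def space_PiM)
  ultimately show ?thesis by simp
qed

text \<open>Fubini, with the noise integrated first and then translated by the superposed codewords.
  The joint probability space is thereby replaced by a finite average of Gaussian masses of output
  sets.\<close>

lemma user_error_prob_eq:
  assumes "N0 > 0" "M \<ge> 1"
    and dec: "dec \<in> measurable (PiM {1..n} (\<lambda>_. borel)) (PiM {1..K} (\<lambda>_. count_space {1..M}))"
    and i: "i \<in> {1..K}"
  shows "user_error_prob N0 K n M x dec i =
    (\<Sum>w\<in>messages K M. measure (gaussian n (superposition K x w) (sqrt (N0 / 2))) (error_set n dec i (w i)))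
      / real M ^ K"
proof -
  let ?A = "uniform_count_measure (messages K M)"
  let ?B = "gaussian n (\<lambda>_. 0) (sqrt (N0 / 2))"
  have s: "sqrt (N0 / 2) > 0"
    using assms by simp
  have ne: "messages K M \<noteq> {}"
    using card_messages[of K M] assms by auto
  interpret A: prob_space ?A
    by (rule prob_space_uniform_count_measure) (use ne in auto)
  interpret B: prob_space ?B
    by (rule prob_space_gaussian[OF s])
  interpret AB: pair_prob_space ?A ?B ..
  let ?X = "{\<omega> \<in> space (?A \<Otimes>\<^sub>M ?B). dec (channel_output K n x (fst \<omega>) (snd \<omega>)) i \<noteq> fst \<omega> i}"
  have sets_A: "sets ?A = Pow (messages K M)"
    by (simp add: sets_uniform_count_measure)
  have space_A: "space ?A = messages K M"
    by (simp add: space_uniform_count_measure)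
  have slice: "(\<lambda>z. channel_output K n x w z) -` error_set n dec i (w i) \<inter> space ?B
      = {z \<in> space ?B. dec (channel_output K n x w z) i \<noteq> w i}" for w
    by (auto simp: error_set_def channel_output_def)
  have slice_meas: "{z \<in> space ?B. dec (channel_output K n x w z) i \<noteq> w i} \<in> sets ?B" for w
    unfolding slice[symmetric]
    by (rule measurable_sets[OF _ error_set_measurable[OF dec i]])
       (unfold channel_output_eq, measurable)
  \<comment> \<open>There are finitely many message tuples, so the event is a finite union of
    rectangles, which yields its measurability.\<close>
  have X_eq: "?X = (\<Union>w\<in>messages K M. {w} \<times> {z \<in> space ?B. dec (channel_output K n x w z) i \<noteq> w i})"
    by (auto simp: space_pair_measure space_A)
  have X: "?X \<in> sets (?A \<Otimes>\<^sub>M ?B)"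
    unfolding X_eq by (intro sets.finite_UN pair_measureI slice_meas) (auto simp: sets_A)
  have "user_error_prob N0 K n M x dec i = measure (?A \<Otimes>\<^sub>M ?B) ?X"
    unfolding user_error_prob_def mac_space_def noise_space_eq message_space_eq[OF assms(2)] ..
  also have "\<dots> = (\<integral>\<omega>. indicator ?X \<omega> \<partial>(?A \<Otimes>\<^sub>M ?B))"
    using X by simp
  also have "\<dots> = (\<integral>w. \<integral>z. indicator ?X (w, z) \<partial>?B \<partial>?A)"
    by (rule AB.integral_fst'[symmetric])
       (use X in \<open>auto intro!: integrable_real_indicator simp: less_top[symmetric]\<close>)
  also have "\<dots> = (\<Sum>w\<in>messages K M. \<integral>z. indicator ?X (w, z) \<partial>?B) / real M ^ K"
    by (subst integral_uniform_count_measure) (simp_all add: card_messages)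
  also have "(\<Sum>w\<in>messages K M. \<integral>z. indicator ?X (w, z) \<partial>?B) =
    (\<Sum>w\<in>messages K M. measure (gaussian n (superposition K x w) (sqrt (N0 / 2))) (error_set n dec i (w i)))"
  proof (rule sum.cong)
    fix w assume w: "w \<in> messages K M"
    have "(\<integral>z. indicator ?X (w, z) \<partial>?B)
        = (\<integral>z. indicator {z \<in> space ?B. dec (channel_output K n x w z) i \<noteq> w i} z \<partial>?B)"
      using w by (intro Bochner_Integration.integral_cong refl)
        (auto simp: indicator_def space_pair_measure space_A)
    also have "\<dots> = measure ?B {z \<in> space ?B. dec (channel_output K n x w z) i \<noteq> w i}"
      using slice_meas by simp
    also have "\<dots> = measure (distr ?B (PiM {1..n} (\<lambda>_. borel)) (channel_output K n x w)) (error_set n dec i (w i))"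
      unfolding slice[symmetric]
      by (rule measure_distr[symmetric, OF _ error_set_measurable[OF dec i]])
         (unfold channel_output_eq[abs_def], measurable)
    also have "\<dots> = measure (gaussian n (superposition K x w) (sqrt (N0 / 2))) (error_set n dec i (w i))"
      unfolding channel_output_eq[abs_def] distr_gaussian_translate[OF s] ..
    finally show "(\<integral>z. indicator ?X (w, z) \<partial>?B) =
      measure (gaussian n (superposition K x w) (sqrt (N0 / 2))) (error_set n dec i (w i))" .
  qed simp
  finally show ?thesis .
qed

subsection \<open>Necessary conditions on rate and energy\<close>

lemma sum_PiE_insert:
  fixes F :: "('a \<Rightarrow> 'b) \<Rightarrow> real"
  assumes "i \<notin> I"
  shows "(\<Sum>w\<in>PiE (insert i I) (\<lambda>_. B). F w) = (\<Sum>v\<in>B. \<Sum>w\<in>PiE I (\<lambda>_. B). F (w(i := v)))"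
proof -
  have "(\<Sum>w\<in>PiE (insert i I) (\<lambda>_. B). F w) = (\<Sum>(v, w)\<in>B \<times> PiE I (\<lambda>_. B). F (w(i := v)))"
    unfolding PiE_insert_eq
    by (subst sum.reindex[OF inj_combinator[OF assms]]) (simp add: case_prod_unfold)
  then show ?thesis
    by (simp add: sum.cartesian_product)
qed

text \<open>Variances of independent centered terms add: in the induction the cross term carries the
  vanishing sum of \<open>c i\<close>. Averages are kept as sums, hence the factor
  \<open>card B ^ card I\<close>.\<close>

lemma sum_PiE_square_centered:
  fixes c :: "'a \<Rightarrow> 'b \<Rightarrow> real"
  assumes "finite I" "finite B" "B \<noteq> {}" and "\<And>i. i \<in> I \<Longrightarrow> (\<Sum>v\<in>B. c i v) = 0"
  shows "(\<Sum>w\<in>PiE I (\<lambda>_. B). (\<Sum>i\<in>I. c i (w i))\<^sup>2) =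
    real (card B) ^ card I * (\<Sum>i\<in>I. (\<Sum>v\<in>B. (c i v)\<^sup>2) / real (card B))"
  using assms(1,4)
proof (induction I rule: finite_induct)
  case (insert i I)
  let ?W = "PiE I (\<lambda>_. B)" and ?S = "\<lambda>w. \<Sum>l\<in>I. c l (w l)"
  have card_B: "real (card B) > 0"
    using assms by (simp add: card_gt_0_iff)
  have "(\<Sum>w\<in>PiE (insert i I) (\<lambda>_. B). (\<Sum>l\<in>insert i I. c l (w l))\<^sup>2)
      = (\<Sum>v\<in>B. \<Sum>w\<in>?W. (c i v + ?S w)\<^sup>2)"
  proof -
    have "(\<Sum>l\<in>insert i I. c l ((w(i := v)) l)) = c i v + ?S w" for v w
      using insert.hyps by (simp, intro sum.cong) auto
    then show ?thesis
      using sum_PiE_insert[OF insert.hyps(2), of "\<lambda>w. (\<Sum>l\<in>insert i I. c l (w l))\<^sup>2" B] by simp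
  qed
  also have "\<dots> = (\<Sum>v\<in>B. \<Sum>w\<in>?W. (c i v)\<^sup>2) + 2 * (\<Sum>v\<in>B. c i v) * (\<Sum>w\<in>?W. ?S w)
      + (\<Sum>v\<in>B. \<Sum>w\<in>?W. (?S w)\<^sup>2)"
    by (simp add: power2_sum sum.distrib sum_distrib_left[symmetric] sum_distrib_right[symmetric])
  also have "\<dots> = real (card B) ^ card I * (\<Sum>v\<in>B. (c i v)\<^sup>2) + real (card B) * (\<Sum>w\<in>?W. (?S w)\<^sup>2)"
    using insert.prems insert.hyps by (simp add: card_PiE sum_distrib_left)
  also have "\<dots> = real (card B) ^ card (insert i I) * (\<Sum>l\<in>insert i I. (\<Sum>v\<in>B. (c l v)\<^sup>2) / real (card B))"
    using insert card_B by (simp add: field_simps)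
  finally show ?case .
qed simp

text \<open>Expanding the square shows that centering at the mean lowers the sum of squares by
  \<open>card B * m^2\<close>.\<close>

lemma sum_square_centered_le:
  fixes a :: "'a \<Rightarrow> real"
  assumes "finite B" "B \<noteq> {}"
  defines "m \<equiv> (\<Sum>v\<in>B. a v) / real (card B)"
  shows "(\<Sum>v\<in>B. (a v - m)\<^sup>2) \<le> (\<Sum>v\<in>B. (a v)\<^sup>2)" and "(\<Sum>v\<in>B. a v - m) = 0"
proof -
  have card_B: "real (card B) > 0"
    using assms by (simp add: card_gt_0_iff)
  have sum_a: "(\<Sum>v\<in>B. a v) = real (card B) * m"
    using card_B by (simp add: m_def)
  show "(\<Sum>v\<in>B. a v - m) = 0"
    by (simp add: sum_subtractf sum_a)
  have "(\<Sum>v\<in>B. (a v - m)\<^sup>2) = (\<Sum>v\<in>B. (a v)\<^sup>2) - 2 * m * (\<Sum>v\<in>B. a v) + real (card B) * m\<^sup>2"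
    by (simp add: power2_diff sum.distrib sum_subtractf sum_distrib_left[symmetric]
        sum_distrib_right[symmetric] mult.commute mult.left_commute)
  also have "\<dots> = (\<Sum>v\<in>B. (a v)\<^sup>2) - real (card B) * m\<^sup>2"
    by (simp add: sum_a power2_eq_square)
  also have "\<dots> \<le> (\<Sum>v\<in>B. (a v)\<^sup>2)"
    by simp
  finally show "(\<Sum>v\<in>B. (a v - m)\<^sup>2) \<le> (\<Sum>v\<in>B. (a v)\<^sup>2)" .
qed

text \<open>The messages of different users are independent, so in each coordinate their variances
  add; over all coordinates a user contributes at most its energy. \<open>\<mu>\<close> is the mean
  noiseless output under uniform messages.\<close>

lemma superposition_variance_le:
  assumes "M \<ge> 1"
    and energy: "\<And>i v. i \<in> {1..K} \<Longrightarrow> v \<in> {1..M} \<Longrightarrow> (\<Sum>j=1..n. (x i v j)\<^sup>2) \<le> E"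
  defines "\<mu> \<equiv> \<lambda>j. \<Sum>i=1..K. (\<Sum>v=1..M. x i v j) / real M"
  shows "(\<Sum>w\<in>messages K M. \<Sum>j=1..n. (superposition K x w j - \<mu> j)\<^sup>2) \<le> real M ^ K * (real K * E)"
proof -
  let ?m = "\<lambda>i j. (\<Sum>v=1..M. x i v j) / real M"
  have B: "finite {1..M}" "{1..M} \<noteq> {}"
    using assms by auto
  have "(\<Sum>w\<in>messages K M. \<Sum>j=1..n. (superposition K x w j - \<mu> j)\<^sup>2)
      = (\<Sum>j=1..n. \<Sum>w\<in>PiE {1..K} (\<lambda>_. {1..M}). (\<Sum>i=1..K. x i (w i) j - ?m i j)\<^sup>2)"
    unfolding messages_def by (subst sum.swap) (simp add: superposition_def \<mu>_def sum_subtractf)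
  also have "\<dots> = (\<Sum>j=1..n. real M ^ K * (\<Sum>i=1..K. (\<Sum>v=1..M. (x i v j - ?m i j)\<^sup>2) / real M))"
  proof (rule sum.cong[OF refl])
    fix j
    show "(\<Sum>w\<in>PiE {1..K} (\<lambda>_. {1..M}). (\<Sum>i=1..K. x i (w i) j - ?m i j)\<^sup>2)
        = real M ^ K * (\<Sum>i=1..K. (\<Sum>v=1..M. (x i v j - ?m i j)\<^sup>2) / real M)"
      using sum_PiE_square_centered[of "{1..K}" "{1..M}" "\<lambda>i v. x i v j - ?m i j"]
        sum_square_centered_le(2)[OF B, of "\<lambda>v. x _ v j"] B by simp
  qed
  also have "\<dots> \<le> (\<Sum>j=1..n. real M ^ K * (\<Sum>i=1..K. (\<Sum>v=1..M. (x i v j)\<^sup>2) / real M))"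
  proof (rule sum_mono, rule mult_left_mono, rule sum_mono, rule divide_right_mono)
    fix i j
    show "(\<Sum>v=1..M. (x i v j - ?m i j)\<^sup>2) \<le> (\<Sum>v=1..M. (x i v j)\<^sup>2)"
      using sum_square_centered_le(1)[OF B, of "\<lambda>v. x i v j"] by simp
  qed simp_all
  also have "\<dots> = real M ^ K * (\<Sum>i=1..K. (\<Sum>v=1..M. \<Sum>j=1..n. (x i v j)\<^sup>2) / real M)"
    unfolding sum_distrib_left[symmetric] sum_divide_distrib[symmetric]
    by (subst sum.swap, intro arg_cong2[where f = "(*)"] arg_cong2[where f = "(/)"] sum.cong refl sum.swap)
  also have "\<dots> \<le> real M ^ K * (\<Sum>i=1..K. (\<Sum>v=1..M. E) / real M)"
    by (intro mult_left_mono sum_mono divide_right_mono energy) auto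
  also have "\<dots> = real M ^ K * (real K * E)"
    using assms by simp
  finally show ?thesis .
qed

section \<open>Sum-rate converse\<close>

text \<open>The error constraint with both averages, over users and over message tuples, multiplied
  out.\<close>

lemma sum_error_measure_le:
  assumes "N0 > 0" "K \<ge> 1" and code: "ape_code N0 K n M E \<epsilon> x dec"
  shows "(\<Sum>i=1..K. \<Sum>w\<in>messages K M.
      measure (gaussian n (superposition K x w) (sqrt (N0 / 2))) (error_set n dec i (w i)))
    \<le> \<epsilon> * real K * real M ^ K"
proof -
  have "M \<ge> 1" and "average_error_prob N0 K n M x dec \<le> \<epsilon>"
    and "dec \<in> measurable (PiM {1..n} (\<lambda>_. borel)) (PiM {1..K} (\<lambda>_. count_space {1..M}))"
    using code by (auto simp: ape_code_def)
  then have "(\<Sum>i=1..K. (\<Sum>w\<in>messages K M.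
      measure (gaussian n (superposition K x w) (sqrt (N0 / 2))) (error_set n dec i (w i))) / real M ^ K)
    \<le> \<epsilon> * real K"
    using assms by (simp add: average_error_prob_def user_error_prob_eq field_simps)
  then show ?thesis
    using \<open>M \<ge> 1\<close> by (simp add: sum_divide_distrib[symmetric] field_simps)
qed

text \<open>This plays the role of Fano's inequality. The score \<open>f w\<close> gains
  \<open>ln M - ln 2\<close> for every correctly decoded user and \<open>- ln 2\<close> for every
  other one, and for each output its exponential averages to at most 1 over the tuples. Hence the
  expected score is at most the average divergence to the comparison law, which is bounded by the
  Gaussian sum-capacity expression.\<close>

lemma sum_rate_bound:
  assumes "N0 > 0" "n \<ge> 1" "K \<ge> 1" and code: "ape_code N0 K n M E \<epsilon> x dec"
  shows "(1 - \<epsilon>) * ln (real M) \<le> ln 2 + real n / (2 * real K) * ln (1 + 2 * real K * E / (real n * N0))"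
proof -
  have M: "M \<ge> 1" and E: "E > 0"
    and energy: "\<And>i v. i \<in> {1..K} \<Longrightarrow> v \<in> {1..M} \<Longrightarrow> (\<Sum>j=1..n. (x i v j)\<^sup>2) \<le> E"
    and dec: "dec \<in> measurable (PiM {1..n} (\<lambda>_. borel)) (PiM {1..K} (\<lambda>_. count_space {1..M}))"
    using code by (auto simp: ape_code_def)
  define \<sigma> where "\<sigma> = sqrt (N0 / 2)"
  \<comment> \<open>Noise variance plus the bound \<open>K * E / n\<close> on the average signal
    variance per symbol. With this value the non-logarithmic terms of the divergence bound
    cancel.\<close>
  define \<tau> where "\<tau> = sqrt (N0 / 2 + real K * E / real n)"
  define \<mu> where "\<mu> = (\<lambda>j. \<Sum>i=1..K. (\<Sum>v=1..M. x i v j) / real M)"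
  let ?P = "\<lambda>w. gaussian n (superposition K x w) \<sigma>" and ?Q = "gaussian n \<mu> \<tau>"
  let ?L = "ln (real M)"
  define e where "e = (\<lambda>i w. measure (?P w) (error_set n dec i (w i)))"
  \<comment> \<open>The \<open>- ln 2\<close> normalises the score: for one user, the exponential
    summed over the messages is at most \<open>M / 2 + M / 2\<close>.\<close>
  define f where "f = (\<lambda>w y. \<Sum>i=1..K. ?L * (1 - indicator (error_set n dec i (w i)) y) - ln 2)"
  have pos: "\<sigma> > 0" "\<tau> > 0" "\<sigma>\<^sup>2 = N0 / 2" "\<tau>\<^sup>2 = N0 / 2 + real K * E / real n"
    using assms E by (auto simp: \<sigma>_def \<tau>_def intro!: add_pos_nonneg)
  have L: "?L \<ge> 0"
    using M by simp
  interpret Q: prob_space ?Q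
    by (rule prob_space_gaussian) fact
  have f_meas: "f w \<in> borel_measurable (PiM {1..n} (\<lambda>_. borel))" if "w \<in> messages K M" for w
    unfolding f_def using error_set_measurable[OF dec]
    by (intro borel_measurable_sum borel_measurable_diff borel_measurable_times borel_measurable_indicator
        borel_measurable_const) auto
  have f_bound: "\<bar>f w y\<bar> \<le> real K * (?L + ln 2)" for w y
  proof -
    have "\<bar>f w y\<bar> \<le> (\<Sum>i=1..K. ?L + ln 2)"
      unfolding f_def
    proof (rule order_trans[OF sum_abs], rule sum_mono)
      fix i
      show "\<bar>?L * (1 - indicator (error_set n dec i (w i)) y) - ln 2\<bar> \<le> ?L + ln 2"
        using L by (auto simp: indicator_def abs_le_iff)
    qed
    then show ?thesis by simp
  qed
  have int_f: "(\<integral>y. f w y \<partial>?P w) = (\<Sum>i=1..K. ?L * (1 - e i w) - ln 2)" if "w \<in> messages K M" for w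
  proof -
    interpret P: prob_space "?P w"
      by (rule prob_space_gaussian) fact
    have [simp]: "error_set n dec i (w i) \<in> P.events" if "i \<in> {1..K}" for i
      using error_set_measurable[OF dec that] by (simp add: sets_gaussian)
    have "(\<integral>y. f w y \<partial>?P w) = (\<Sum>i=1..K. \<integral>y. ?L * (1 - indicator (error_set n dec i (w i)) y) - ln 2 \<partial>?P w)"
      unfolding f_def by (rule Bochner_Integration.integral_sum) (simp add: less_top[symmetric])
    also have "\<dots> = (\<Sum>i=1..K. ?L * (1 - e i w) - ln 2)"
      by (intro sum.cong refl) (simp add: e_def P.prob_space less_top[symmetric])
    finally show ?thesis .
  qed
  \<comment> \<open>For a fixed output the exponential is a product over users of functions of one
    message each, so the sum over tuples becomes a product of sums over messages.\<close>
  have exp_f: "(\<Sum>w\<in>messages K M. exp (f w y)) \<le> real M ^ K" if y: "y \<in> space ?Q" for y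
  proof -
    have "(\<Sum>w\<in>messages K M. exp (f w y))
        = (\<Sum>w\<in>PiE {1..K} (\<lambda>_. {1..M}). \<Prod>i=1..K. (if w i = dec y i then real M else 1) / 2)"
      unfolding messages_def
    proof (rule sum.cong[OF refl])
      fix w
      have "exp (?L * (1 - indicator (error_set n dec i (w i)) y) - ln 2)
          = (if w i = dec y i then real M else 1) / 2" for i
        using M y by (auto simp: exp_diff error_set_def space_gaussian indicator_def)
      then show "exp (f w y) = (\<Prod>i=1..K. (if w i = dec y i then real M else 1) / 2)"
        by (simp only: f_def exp_sum finite_atLeastAtMost)
    qed
    also have "\<dots> = (\<Prod>i=1..K. \<Sum>v=1..M. (if v = dec y i then real M else 1) / 2)"
      by (rule prod_sum_PiE[symmetric]) auto
    also have "\<dots> \<le> (\<Prod>i=1..K. real M)"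
    proof (intro prod_mono conjI sum_nonneg)
      fix i
      have "(\<Sum>v=1..M. (if v = dec y i then real M else 1) / 2)
          \<le> (\<Sum>v=1..M. 1 / 2 + (if v = dec y i then real M / 2 else 0))"
        by (intro sum_mono) auto
      also have "\<dots> \<le> real M"
        by (simp add: sum.distrib)
      finally show "(\<Sum>v=1..M. (if v = dec y i then real M else 1) / 2) \<le> real M" .
    qed auto
    finally show ?thesis by simp
  qed
  have int_exp_f: "integrable ?Q (\<lambda>y. exp (f w y))" if "w \<in> messages K M" for w
  proof (rule Q.integrable_const_bound[where B = "exp (real K * (?L + ln 2))"])
    show "AE y in ?Q. norm (exp (f w y)) \<le> exp (real K * (?L + ln 2))"
      using f_bound by (auto simp: abs_le_iff)
    show "(\<lambda>y. exp (f w y)) \<in> borel_measurable ?Q"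
      using f_meas[OF that] by (simp add: measurable_cong_sets[OF sets_gaussian refl])
  qed
  have "(\<Sum>w\<in>messages K M. \<integral>y. exp (f w y) \<partial>?Q) = (\<integral>y. (\<Sum>w\<in>messages K M. exp (f w y)) \<partial>?Q)"
    by (rule Bochner_Integration.integral_sum[symmetric]) (rule int_exp_f)
  also have "\<dots> \<le> (\<integral>y. real M ^ K \<partial>?Q)"
    by (intro integral_mono exp_f Bochner_Integration.integrable_sum int_exp_f) auto
  finally have exp_total: "(\<Sum>w\<in>messages K M. \<integral>y. exp (f w y) \<partial>?Q) \<le> real M ^ K"
    by (simp add: Q.prob_space)
  have var: "(\<Sum>w\<in>messages K M. \<Sum>j=1..n. (superposition K x w j - \<mu> j)\<^sup>2) \<le> real M ^ K * (real K * E)"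
    unfolding \<mu>_def by (rule superposition_variance_le) (use M energy in auto)
  define D where "D = real n * (ln (\<tau> / \<sigma>) + \<sigma>\<^sup>2 / (2 * \<tau>\<^sup>2) - 1 / 2)"
  have "(\<Sum>w\<in>messages K M. \<Sum>i=1..K. ?L * (1 - e i w) - ln 2)
      \<le> (\<Sum>w\<in>messages K M. D + (\<Sum>j=1..n. (superposition K x w j - \<mu> j)\<^sup>2) / (2 * \<tau>\<^sup>2)
          + (\<integral>y. exp (f w y) \<partial>?Q) - 1)"
    unfolding D_def
    by (intro sum_mono, subst int_f[symmetric], assumption,
        rule gaussian_change_of_measure[OF pos(1,2) f_meas f_bound])
  also have "\<dots> = real M ^ K * D
      + (\<Sum>w\<in>messages K M. \<Sum>j=1..n. (superposition K x w j - \<mu> j)\<^sup>2) / (2 * \<tau>\<^sup>2)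
      + (\<Sum>w\<in>messages K M. \<integral>y. exp (f w y) \<partial>?Q) - real M ^ K"
    by (simp add: sum.distrib sum_subtractf card_messages sum_divide_distrib)
  \<comment> \<open>The exponential terms total at most \<open>M ^ K\<close>, which the
    \<open>- 1\<close> of each of the \<open>M ^ K\<close> tuples cancels.\<close>
  also have "\<dots> \<le> real M ^ K * D + real M ^ K * (real K * E) / (2 * \<tau>\<^sup>2) + real M ^ K - real M ^ K"
    by (intro diff_right_mono add_mono divide_right_mono var exp_total order_refl) auto
  also have "\<dots> = real M ^ K * (D + real K * E / (2 * \<tau>\<^sup>2))"
    by (simp add: algebra_simps)
  finally have upper: "(\<Sum>w\<in>messages K M. \<Sum>i=1..K. ?L * (1 - e i w) - ln 2)
      \<le> real M ^ K * (D + real K * E / (2 * \<tau>\<^sup>2))" .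
  have "(\<Sum>w\<in>messages K M. \<Sum>i=1..K. ?L * (1 - e i w) - ln 2)
      = ?L * (real K * real M ^ K - (\<Sum>i=1..K. \<Sum>w\<in>messages K M. e i w)) - real M ^ K * real K * ln 2"
    by (subst (2) sum.swap)
      (simp add: sum_subtractf sum_distrib_left[symmetric] card_messages right_diff_distrib)
  moreover have "(\<Sum>i=1..K. \<Sum>w\<in>messages K M. e i w) \<le> \<epsilon> * real K * real M ^ K"
    unfolding e_def \<sigma>_def by (rule sum_error_measure_le) fact+
  then have "?L * (\<Sum>i=1..K. \<Sum>w\<in>messages K M. e i w) \<le> ?L * (\<epsilon> * real K * real M ^ K)"
    by (rule mult_left_mono) fact
  ultimately have "real M ^ K * (real K * ((1 - \<epsilon>) * ?L - ln 2))
      \<le> (\<Sum>w\<in>messages K M. \<Sum>i=1..K. ?L * (1 - e i w) - ln 2)"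
    by (simp add: algebra_simps)
  also note upper
  finally have "real K * ((1 - \<epsilon>) * ?L - ln 2) \<le> D + real K * E / (2 * \<tau>\<^sup>2)"
    using M by simp
  also have "\<dots> = real n * ln (\<tau> / \<sigma>)"
  proof -
    have "real n * (\<sigma>\<^sup>2 / (2 * \<tau>\<^sup>2) - 1 / 2) + real K * E / (2 * \<tau>\<^sup>2)
        = real n * (\<sigma>\<^sup>2 + real K * E / real n - \<tau>\<^sup>2) / (2 * \<tau>\<^sup>2)"
      using assms pos(2) by (simp add: field_simps)
    also have "\<dots> = 0"
      by (simp add: pos)
    finally show ?thesis
      by (simp add: D_def algebra_simps)
  qed
  also have "ln (\<tau> / \<sigma>) = ln ((\<tau> / \<sigma>)\<^sup>2) / 2"
    using pos by (simp add: ln_realpow)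
  also have "(\<tau> / \<sigma>)\<^sup>2 = 1 + 2 * real K * E / (real n * N0)"
    using assms by (simp add: power_divide pos field_simps)
  finally show ?thesis
    using assms by (simp add: field_simps)
qed

section \<open>Energy forced by a small error probability\<close>

text \<open>For \<open>M >= 2\<close> this permutation has no fixed point; it pairs every message
  with a different one while preserving uniform averages.\<close>

lemma bij_betw_cyclic_shift:
  "bij_betw (\<lambda>v. if v = M then 1 else Suc v) {1..M} {1..M}"
  by (rule bij_betw_byWitness[where f' = "\<lambda>v. if v = 1 then M else v - 1"]) auto

text \<open>Two tuples that differ in the message of one user have mean outputs at squared distance
  at most \<open>4 * E\<close>, so the divergence of their output laws is at most
  \<open>4 * E / N0\<close>. An output decoded correctly for one is an error for the other, and
  \<open>t\<close> times the indicator of that error set is the function used in the change of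
  measure.\<close>

lemma energy_lower_bound:
  assumes "N0 > 0" "K \<ge> 1" "M \<ge> 2" and code: "ape_code N0 K n M E \<epsilon> x dec" and t: "t \<ge> 0"
  shows "t * (1 - \<epsilon>) \<le> 4 * E / N0 + (exp t - 1) * \<epsilon>"
proof -
  have energy: "\<And>i v. i \<in> {1..K} \<Longrightarrow> v \<in> {1..M} \<Longrightarrow> (\<Sum>j=1..n. (x i v j)\<^sup>2) \<le> E"
    and dec: "dec \<in> measurable (PiM {1..n} (\<lambda>_. borel)) (PiM {1..K} (\<lambda>_. count_space {1..M}))"
    using code by (auto simp: ape_code_def)
  define \<sigma> where "\<sigma> = sqrt (N0 / 2)"
  have pos: "\<sigma> > 0" "\<sigma>\<^sup>2 = N0 / 2"
    using assms by (auto simp: \<sigma>_def)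
  let ?P = "\<lambda>w. gaussian n (superposition K x w) \<sigma>"
  define e where "e = (\<lambda>i w. measure (?P w) (error_set n dec i (w i)))"
  define next_msg where "next_msg = (\<lambda>v. if v = M then 1 else Suc v)"
  have next_mem: "next_msg v \<in> {1..M}" "next_msg v \<noteq> v" if "v \<in> {1..M}" for v
    using that assms by (auto simp: next_msg_def)
  define shift where "shift = (\<lambda>(i::nat) w. w(i := next_msg (w i)))"
  have one: "t * (1 - e i (shift i w)) \<le> 4 * E / N0 + (exp t - 1) * e i w"
    if i: "i \<in> {1..K}" and w: "w \<in> messages K M" for i w
  proof -
    let ?w' = "shift i w" and ?A = "error_set n dec i (w i)"
    interpret P: prob_space "?P w" by (rule prob_space_gaussian) fact
    interpret P': prob_space "?P ?w'" by (rule prob_space_gaussian) fact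
    have A: "error_set n dec i v \<in> sets (?P u)" for u v
      using error_set_measurable[OF dec i] by (simp add: sets_gaussian)
    have wi: "w i \<in> {1..M}"
      using messages_mem[OF w i] .
    have "1 - e i ?w' = measure (?P ?w') (space (?P ?w') - error_set n dec i (?w' i))"
      unfolding e_def by (rule P'.prob_compl[symmetric]) (rule A)
    \<comment> \<open>If user \<open>i\<close> is decoded as \<open>next_msg (w i)\<close>, then it
      is not decoded as \<open>w i\<close>.\<close>
    also have "\<dots> \<le> measure (?P ?w') ?A"
      by (rule P'.finite_measure_mono[OF _ A])
         (use next_mem(2)[OF wi] in \<open>auto simp: error_set_def space_gaussian shift_def\<close>)
    finally have "t * (1 - e i ?w') \<le> t * measure (?P ?w') ?A"
      by (rule mult_left_mono) fact
    also have "\<dots> = (\<integral>y. t * indicator ?A y \<partial>?P ?w')"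
      using A by simp
    \<comment> \<open>Both laws have the same variance, so the first summand vanishes.\<close>
    also have "\<dots> \<le> real n * (ln (\<sigma> / \<sigma>) + \<sigma>\<^sup>2 / (2 * \<sigma>\<^sup>2) - 1 / 2)
        + (\<Sum>j=1..n. (superposition K x ?w' j - superposition K x w j)\<^sup>2) / (2 * \<sigma>\<^sup>2)
        + (\<integral>y. exp (t * indicator ?A y) \<partial>?P w) - 1"
    proof (rule gaussian_change_of_measure[OF pos(1) pos(1)])
      show "(\<lambda>y. t * indicator ?A y) \<in> borel_measurable (PiM {1..n} (\<lambda>_. borel))"
        using error_set_measurable[OF dec i] by measurable
      show "\<bar>t * indicator ?A y\<bar> \<le> t" for y :: "nat \<Rightarrow> real"
        using t by (auto simp: indicator_def)
    qed
    also have "(\<integral>y. exp (t * indicator ?A y) \<partial>?P w) = (\<integral>y. 1 + (exp t - 1) * indicator ?A y \<partial>?P w)"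
      by (intro Bochner_Integration.integral_cong refl) (auto simp: indicator_def)
    also have "\<dots> = 1 + (exp t - 1) * e i w"
      using A by (simp add: P.prob_space e_def less_top[symmetric])
    also have "(\<Sum>j=1..n. (superposition K x ?w' j - superposition K x w j)\<^sup>2)
        = (\<Sum>j=1..n. (x i (next_msg (w i)) j - x i (w i) j)\<^sup>2)"
    proof (intro sum.cong refl)
      fix j
      have "superposition K x ?w' j - superposition K x w j
          = (\<Sum>l=1..K. if l = i then x i (next_msg (w i)) j - x i (w i) j else 0)"
        unfolding superposition_def sum_subtractf[symmetric] by (intro sum.cong) (auto simp: shift_def)
      then show "(superposition K x ?w' j - superposition K x w j)\<^sup>2 = (x i (next_msg (w i)) j - x i (w i) j)\<^sup>2"
        using i by simp
    qed
    finally have "t * (1 - e i ?w') \<le>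
        (\<Sum>j=1..n. (x i (next_msg (w i)) j - x i (w i) j)\<^sup>2) / N0 + (exp t - 1) * e i w"
      using pos assms(1) by simp
    moreover have "(\<Sum>j=1..n. (x i (next_msg (w i)) j - x i (w i) j)\<^sup>2)
        \<le> (\<Sum>j=1..n. 2 * (x i (next_msg (w i)) j)\<^sup>2 + 2 * (x i (w i) j)\<^sup>2)"
    proof (rule sum_mono)
      fix j
      show "(x i (next_msg (w i)) j - x i (w i) j)\<^sup>2 \<le> 2 * (x i (next_msg (w i)) j)\<^sup>2 + 2 * (x i (w i) j)\<^sup>2"
        using zero_le_power2[of "x i (next_msg (w i)) j + x i (w i) j"]
        by (simp add: power2_diff power2_sum)
    qed
    moreover have "\<dots> \<le> 4 * E"
      using energy[OF i wi] energy[OF i next_mem(1)[OF wi]]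
      by (simp add: sum.distrib sum_distrib_left[symmetric])
    ultimately show ?thesis
      using divide_right_mono[of "\<Sum>j=1..n. (x i (next_msg (w i)) j - x i (w i) j)\<^sup>2" "4 * E" N0] assms
      by linarith
  qed
  \<comment> \<open>Since the shift permutes the tuples, the errors at \<open>shift i w\<close> and
    at \<open>w\<close> have the same total.\<close>
  have shift_bij: "bij_betw (shift i) (messages K M) (messages K M)" if i: "i \<in> {1..K}" for i
  proof -
    have "inj_on next_msg {1..M}"
      using bij_betw_cyclic_shift[of M] by (simp add: next_msg_def bij_betw_def)
    then have "u = w" if "shift i u = shift i w" "u \<in> messages K M" "w \<in> messages K M" for u w
    proof -
      have "next_msg (u i) = next_msg (w i)"
        using fun_cong[OF that(1), of i] by (simp add: shift_def)
      then have "u i = w i"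
        using inj_onD[OF \<open>inj_on next_msg {1..M}\<close>] messages_mem[OF that(2) i] messages_mem[OF that(3) i]
        by blast
      moreover have "u l = w l" if "l \<noteq> i" for l
        using fun_cong[OF \<open>shift i u = shift i w\<close>, of l] that by (simp add: shift_def)
      ultimately show ?thesis by (metis ext)
    qed
    then have inj: "inj_on (shift i) (messages K M)"
      by (auto intro: inj_onI)
    have "shift i w \<in> messages K M" if w: "w \<in> messages K M" for w
      using w i next_mem(1)[OF messages_mem[OF w i]]
      unfolding shift_def messages_def by (auto simp: PiE_iff extensional_def)
    then have "shift i ` messages K M = messages K M"
      using inj by (intro endo_inj_surj) auto
    then show ?thesis
      using inj by (simp add: bij_betw_def)
  qed
  let ?S = "\<Sum>i=1..K. \<Sum>w\<in>messages K M. e i w"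
  have "t * (real K * real M ^ K - ?S) = (\<Sum>i=1..K. \<Sum>w\<in>messages K M. t * (1 - e i w))"
    by (simp add: sum_subtractf sum_distrib_left[symmetric] card_messages)
  also have "\<dots> = (\<Sum>i=1..K. \<Sum>w\<in>messages K M. t * (1 - e i (shift i w)))"
    by (intro sum.cong refl sum.reindex_bij_betw[OF shift_bij, symmetric])
  also have "\<dots> \<le> (\<Sum>i=1..K. \<Sum>w\<in>messages K M. 4 * E / N0 + (exp t - 1) * e i w)"
    by (intro sum_mono one)
  also have "\<dots> = real K * real M ^ K * (4 * E / N0) + (exp t - 1) * ?S"
    by (simp add: sum.distrib sum_distrib_left[symmetric] card_messages)
  finally have "t * (real K * real M ^ K) \<le> real K * real M ^ K * (4 * E / N0) + (exp t - 1 + t) * ?S"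
    by (simp add: algebra_simps)
  also have "(exp t - 1 + t) * ?S \<le> (exp t - 1 + t) * (\<epsilon> * real K * real M ^ K)"
    using t sum_error_measure_le[OF assms(1,2) code]
    by (intro mult_left_mono) (auto simp: e_def \<sigma>_def)
  finally have "(real K * real M ^ K) * (t * (1 - \<epsilon>)) \<le> (real K * real M ^ K) * (4 * E / N0 + (exp t - 1) * \<epsilon>)"
    by (simp add: algebra_simps)
  then show ?thesis
    by (rule mult_left_le_imp_le) (use assms in simp)
qed

subsection \<open>Pulse position codes\<close>

text \<open>The sign of \<open>c\<close> selects the upper or the lower tail.\<close>

lemma normal_tail:
  fixes a c s :: real
  assumes "s > 0"
  shows "measure (density lborel (normal_density a s)) {y. c\<^sup>2 \<le> (y - a) * c} \<le> exp (- c\<^sup>2 / (2 * s\<^sup>2))"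
proof -
  have [measurable]: "{y. c\<^sup>2 \<le> (y - a) * c} \<in> sets borel"
    by measurable
  \<comment> \<open>Exponential tilting: on the event the density is dominated by a multiple of the
    density centred at \<open>a + c\<close>, whose total mass is 1.\<close>
  have le: "normal_density a s y \<le> exp (- c\<^sup>2 / (2 * s\<^sup>2)) * normal_density (a + c) s y"
    if "c\<^sup>2 \<le> (y - a) * c" for y
  proof -
    have "(y - (a + c))\<^sup>2 + c\<^sup>2 \<le> (y - a)\<^sup>2"
      using that by (simp add: power2_eq_square algebra_simps)
    then have "- (y - a)\<^sup>2 / (2 * s\<^sup>2) \<le> - c\<^sup>2 / (2 * s\<^sup>2) + - (y - (a + c))\<^sup>2 / (2 * s\<^sup>2)"
      unfolding add_divide_distrib[symmetric] by (intro divide_right_mono) auto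
    then have "exp (- (y - a)\<^sup>2 / (2 * s\<^sup>2)) \<le> exp (- c\<^sup>2 / (2 * s\<^sup>2)) * exp (- (y - (a + c))\<^sup>2 / (2 * s\<^sup>2))"
      by (simp only: exp_add[symmetric] exp_le_cancel_iff)
    then show ?thesis
      unfolding normal_density_def using mult_left_mono[of _ _ "1 / sqrt (2 * pi * s\<^sup>2)"]
      by (simp add: mult.left_commute mult.assoc divide_right_mono)
  qed
  interpret N: prob_space "density lborel (normal_density a s)"
    by (rule prob_space_normal_density) fact
  interpret N': prob_space "density lborel (normal_density (a + c) s)"
    by (rule prob_space_normal_density) fact
  have "emeasure (density lborel (normal_density a s)) {y. c\<^sup>2 \<le> (y - a) * c}
      = (\<integral>\<^sup>+y. ennreal (normal_density a s y) * indicator {y. c\<^sup>2 \<le> (y - a) * c} y \<partial>lborel)"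
    by (rule emeasure_density) auto
  also have "\<dots> \<le> (\<integral>\<^sup>+y. ennreal (exp (- c\<^sup>2 / (2 * s\<^sup>2))) * ennreal (normal_density (a + c) s y) \<partial>lborel)"
    using le by (intro nn_integral_mono) (auto simp: indicator_def ennreal_mult[symmetric] intro!: ennreal_leI)
  also have "\<dots> = ennreal (exp (- c\<^sup>2 / (2 * s\<^sup>2))) * (\<integral>\<^sup>+y. ennreal (normal_density (a + c) s y) \<partial>lborel)"
    by (rule nn_integral_cmult) simp
  also have "(\<integral>\<^sup>+y. ennreal (normal_density (a + c) s y) \<partial>lborel) = 1"
    using N'.emeasure_space_1 by (simp add: emeasure_density)
  finally show ?thesis
    by (simp add: N.emeasure_eq_measure)
qed

lemma gaussian_tail:
  assumes "s > 0" "j \<in> {1..n}"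
  shows "{y \<in> PiE {1..n} (\<lambda>_. UNIV). c\<^sup>2 \<le> (y j - m j) * c} \<in> sets (gaussian n m s)"
    and "measure (gaussian n m s) {y \<in> PiE {1..n} (\<lambda>_. UNIV). c\<^sup>2 \<le> (y j - m j) * c} \<le> exp (- c\<^sup>2 / (2 * s\<^sup>2))"
proof -
  let ?N = "density lborel (normal_density (m j) s)"
  have component: "(\<lambda>y. y j) \<in> measurable (gaussian n m s) ?N"
    unfolding gaussian_def by (rule measurable_component_singleton) fact
  have A: "{y. c\<^sup>2 \<le> (y - m j) * c} \<in> sets ?N"
    by simp
  have vimage: "(\<lambda>y. y j) -` {y. c\<^sup>2 \<le> (y - m j) * c} \<inter> space (gaussian n m s)
      = {y \<in> PiE {1..n} (\<lambda>_. UNIV). c\<^sup>2 \<le> (y j - m j) * c}"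
    by (auto simp: space_gaussian)
  show "{y \<in> PiE {1..n} (\<lambda>_. UNIV). c\<^sup>2 \<le> (y j - m j) * c} \<in> sets (gaussian n m s)"
    using measurable_sets[OF component A] by (simp only: vimage)
  show "measure (gaussian n m s) {y \<in> PiE {1..n} (\<lambda>_. UNIV). c\<^sup>2 \<le> (y j - m j) * c} \<le> exp (- c\<^sup>2 / (2 * s\<^sup>2))"
    using measure_distr[OF component A] normal_tail[OF assms(1), of "m j" c]
    by (simp only: vimage distr_gaussian_component[OF assms])
qed

section \<open>Pulse position modulation with threshold detection\<close>

text \<open>User \<open>i\<close> owns the channel uses from \<open>(i - 1) * M + 1\<close> to
  \<open>i * M\<close>; the offset \<open>i - 1\<close> reflects that users are counted from
  1.\<close>

definition slot :: "nat \<Rightarrow> nat \<Rightarrow> nat \<Rightarrow> nat" where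
  "slot M i v = (i - 1) * M + v"

definition pulse_code :: "nat \<Rightarrow> real \<Rightarrow> nat \<Rightarrow> codebook" where
  "pulse_code M E i v j = (if j = slot M i v then sqrt E else 0)"

text \<open>The disjunct \<open>v = M\<close> ensures that \<open>LEAST\<close> never ranges over an empty set.\<close>

definition threshold_decoder :: "nat \<Rightarrow> nat \<Rightarrow> real \<Rightarrow> (nat \<Rightarrow> real) \<Rightarrow> nat \<Rightarrow> nat" where
  "threshold_decoder K M \<theta> y =
     (\<lambda>i\<in>{1..K}. LEAST v. v \<in> {1..M} \<and> (v = M \<or> \<theta> < y (slot M i v)))"

text \<open>After lowering everything by 1, \<open>i - 1\<close> is the quotient and
  \<open>v - 1\<close> the remainder on division by \<open>M\<close>.\<close>

lemma slot_inject:
  assumes "slot M i v = slot M l u" "v \<in> {1..M}" "u \<in> {1..M}" "i \<ge> 1" "l \<ge> 1"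
  shows "i = l \<and> v = u"
proof -
  have eq: "(v - 1) + (i - 1) * M = (u - 1) + (l - 1) * M"
    using assms by (auto simp: slot_def)
  have less: "v - 1 < M" "u - 1 < M"
    using assms by auto
  have "((v - 1) + (i - 1) * M) div M = i - 1" "((u - 1) + (l - 1) * M) div M = l - 1"
    using less by auto
  then have "i - 1 = l - 1"
    using eq by simp
  then show ?thesis
    using eq assms by auto
qed

lemma slot_mem:
  assumes "K * M \<le> n" "i \<in> {1..K}" "v \<in> {1..M}"
  shows "slot M i v \<in> {1..n}"
proof -
  have "slot M i v \<le> (i - 1) * M + M"
    using assms by (simp add: slot_def)
  also have "\<dots> = i * M"
    using assms by (cases i) auto
  also have "\<dots> \<le> K * M"
    using assms by simp
  finally show ?thesis
    using assms by (simp add: slot_def)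
qed

text \<open>Different pulses occupy different channel uses, so every summand of the inner product is
  already zero.\<close>

lemma pulse_code_orthogonal: "orthogonal_scheme K n M (pulse_code M E)"
proof -
  have "dot n (pulse_code M E i v) (pulse_code M E l u) = 0"
    if "v \<in> {1..M}" "u \<in> {1..M}" "i \<in> {1..K}" "l \<in> {1..K}" "i \<noteq> l \<or> v \<noteq> u" for i l v u
    unfolding dot_def
  proof (rule sum.neutral, intro ballI)
    fix j
    show "pulse_code M E i v j * pulse_code M E l u j = 0"
      using slot_inject[of M i v l u] that by (auto simp: pulse_code_def)
  qed
  then show ?thesis
    by (auto simp: orthogonal_scheme_def orthogonal_access_def orthogonal_codebook_def)
qed

lemma pulse_code_energy:
  assumes "E \<ge> 0"
  shows "(\<Sum>j=1..n. (pulse_code M E i v j)\<^sup>2) \<le> E"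
proof -
  have "(\<Sum>j=1..n. (pulse_code M E i v j)\<^sup>2) = (\<Sum>j=1..n. if j = slot M i v then E else 0)"
    using assms by (intro sum.cong) (auto simp: pulse_code_def)
  then show ?thesis
    using assms by simp
qed

text \<open>The blocks are disjoint, so no other user contributes at a slot of user
  \<open>i\<close>.\<close>

lemma superposition_pulse_code:
  assumes "w \<in> messages K M" "i \<in> {1..K}" "v \<in> {1..M}"
  shows "superposition K (pulse_code M E) w (slot M i v) = (if v = w i then sqrt E else 0)"
proof -
  have "superposition K (pulse_code M E) w (slot M i v)
      = (\<Sum>l=1..K. if l = i then if v = w i then sqrt E else 0 else 0)"
    unfolding superposition_def
  proof (rule sum.cong[OF refl])
    fix l assume "l \<in> {1..K}"
    then show "pulse_code M E l (w l) (slot M i v) = (if l = i then if v = w i then sqrt E else 0 else 0)"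
      using slot_inject[of M i v l "w l"] messages_mem[OF assms(1), of l] assms
      by (auto simp: pulse_code_def)
  qed
  then show ?thesis
    using assms by simp
qed

lemma threshold_decoder_mem:
  assumes "M \<ge> 1" "i \<in> {1..K}"
  shows "threshold_decoder K M \<theta> y i \<in> {1..M}"
  using LeastI[of "\<lambda>v. v \<in> {1..M} \<and> (v = M \<or> \<theta> < y (slot M i v))" M] assms
  by (simp add: threshold_decoder_def)

lemma threshold_decoder_measurable:
  assumes "M \<ge> 1" "K * M \<le> n"
  shows "threshold_decoder K M \<theta> \<in>
    measurable (PiM {1..n} (\<lambda>_. borel)) (PiM {1..K} (\<lambda>_. count_space {1..M}))"
  unfolding threshold_decoder_def
proof (rule measurable_restrict)
  fix i assume i: "i \<in> {1..K}"
  let ?d = "\<lambda>y. LEAST v. v \<in> {1..M} \<and> (v = M \<or> \<theta> < y (slot M i v))"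
  have d: "?d \<in> measurable (PiM {1..n} (\<lambda>_. borel)) (count_space UNIV)"
  proof (rule measurable_Least)
    fix v
    show "(\<lambda>y. v \<in> {1..M} \<and> (v = M \<or> \<theta> < y (slot M i v)))
        \<in> measurable (PiM {1..n} (\<lambda>_. borel)) (count_space UNIV)"
    proof (cases "v \<in> {1..M}")
      case True
      have [measurable]: "slot M i v \<in> {1..n}"
        by (rule slot_mem) (use assms i True in auto)
      have "(\<lambda>y. v = M \<or> \<theta> < y (slot M i v)) \<in> measurable (PiM {1..n} (\<lambda>_. borel)) (count_space UNIV)"
        by measurable
      moreover have "(\<lambda>y. v \<in> {1..M} \<and> (v = M \<or> \<theta> < y (slot M i v))) = (\<lambda>y. v = M \<or> \<theta> < y (slot M i v))"
        using True by blast
      ultimately show ?thesis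
        by (simp only:)
    qed simp
  qed
  have mem: "?d y \<in> {1..M}" for y
    using threshold_decoder_mem[OF assms(1) i] i by (simp add: threshold_decoder_def)
  show "?d \<in> measurable (PiM {1..n} (\<lambda>_. borel)) (count_space {1..M})"
  proof (subst measurable_count_space_eq2, simp, intro conjI ballI)
    fix v
    show "?d -` {v} \<inter> space (PiM {1..n} (\<lambda>_. borel)) \<in> sets (PiM {1..n} (\<lambda>_. borel))"
      by (rule measurable_sets[OF d]) simp
  qed (use mem in blast)
qed

lemma threshold_decoder_correct:
  assumes "i \<in> {1..K}" "v \<in> {1..M}" "\<theta> < y (slot M i v)"
    and "\<And>u. u \<in> {1..M} \<Longrightarrow> u \<noteq> v \<Longrightarrow> y (slot M i u) \<le> \<theta>"
  shows "threshold_decoder K M \<theta> y i = v"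
proof -
  have "(LEAST v. v \<in> {1..M} \<and> (v = M \<or> \<theta> < y (slot M i v))) = v"
  proof (rule Least_equality)
    \<comment> \<open>The fallback candidate \<open>u = M\<close> is harmless because
      \<open>v <= M\<close>; any other \<open>u\<close> distinct from \<open>v\<close> would have to
      exceed the threshold.\<close>
    fix u assume u: "u \<in> {1..M} \<and> (u = M \<or> \<theta> < y (slot M i u))"
    then show "v \<le> u"
      using assms(2) assms(4)[of u] by (cases "u = v") auto
  qed (use assms in auto)
  then show ?thesis
    using assms by (simp add: threshold_decoder_def)
qed

text \<open>Union bound: an error requires that the sent pulse is received at least
  \<open>a * sqrt E\<close> too low or that one of the fewer than \<open>M\<close> empty slots
  reaches \<open>(1 - a) * sqrt E\<close>.\<close>

lemma pulse_code_error_measure: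
  assumes "s > 0" "E \<ge> 0" "0 < a" "a < 1" "K * M \<le> n" and w: "w \<in> messages K M" and i: "i \<in> {1..K}"
  shows "measure (gaussian n (superposition K (pulse_code M E) w) s)
      (error_set n (threshold_decoder K M ((1 - a) * sqrt E)) i (w i))
    \<le> exp (- (a\<^sup>2 * E) / (2 * s\<^sup>2)) + real M * exp (- ((1 - a)\<^sup>2 * E) / (2 * s\<^sup>2))"
proof -
  let ?m = "superposition K (pulse_code M E) w"
  let ?\<theta> = "(1 - a) * sqrt E"
  let ?T = "\<lambda>v c. {y \<in> PiE {1..n} (\<lambda>_. UNIV). c\<^sup>2 \<le> (y (slot M i v) - ?m (slot M i v)) * c}"
  interpret P: prob_space "gaussian n ?m s"
    by (rule prob_space_gaussian) fact
  have wi: "w i \<in> {1..M}"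
    using messages_mem[OF w i] .
  have slot: "slot M i v \<in> {1..n}" if "v \<in> {1..M}" for v
    by (rule slot_mem) (use assms that in auto)
  note T_sets = gaussian_tail(1)[OF assms(1) slot] and T_measure = gaussian_tail(2)[OF assms(1) slot]
  have T_correct: "?T (w i) (- a * sqrt E) \<in> P.events"
    by (rule T_sets[OF wi])
  have T_others: "(\<Union>v\<in>{1..M} - {w i}. ?T v ?\<theta>) \<in> P.events"
    by (intro sets.finite_UN T_sets) auto
  have sqrt_E: "sqrt E \<ge> 0"
    using assms by simp
  have "error_set n (threshold_decoder K M ?\<theta>) i (w i)
      \<subseteq> ?T (w i) (- a * sqrt E) \<union> (\<Union>v\<in>{1..M} - {w i}. ?T v ?\<theta>)"
  proof
    fix y assume y: "y \<in> error_set n (threshold_decoder K M ?\<theta>) i (w i)"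
    then have "\<not> (?\<theta> < y (slot M i (w i)) \<and> (\<forall>u\<in>{1..M} - {w i}. y (slot M i u) \<le> ?\<theta>))"
      using threshold_decoder_correct[OF i wi, of ?\<theta> y] unfolding error_set_def by blast
    then consider "y (slot M i (w i)) \<le> ?\<theta>" | v where "v \<in> {1..M} - {w i}" "?\<theta> < y (slot M i v)"
      by force
    then show "y \<in> ?T (w i) (- a * sqrt E) \<union> (\<Union>v\<in>{1..M} - {w i}. ?T v ?\<theta>)"
    proof cases
      case 1
      have "(sqrt E - y (slot M i (w i))) * (a * sqrt E) \<ge> (a * sqrt E) * (a * sqrt E)"
        using 1 assms sqrt_E by (intro mult_right_mono) (auto simp: algebra_simps)
      then have "y \<in> ?T (w i) (- a * sqrt E)"
        using y superposition_pulse_code[OF w i wi, of E]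
        by (simp add: error_set_def power2_eq_square algebra_simps)
      then show ?thesis by blast
    next
      case 2
      have "y (slot M i v) * ?\<theta> \<ge> ?\<theta> * ?\<theta>"
        using 2 assms sqrt_E by (intro mult_right_mono) auto
      then have "y \<in> ?T v ?\<theta>"
        using y 2 superposition_pulse_code[OF w i, of v E]
        by (simp add: error_set_def power2_eq_square)
      then show ?thesis using 2 by blast
    qed
  qed
  then have "measure (gaussian n ?m s) (error_set n (threshold_decoder K M ?\<theta>) i (w i))
      \<le> measure (gaussian n ?m s) (?T (w i) (- a * sqrt E) \<union> (\<Union>v\<in>{1..M} - {w i}. ?T v ?\<theta>))"
    by (rule P.finite_measure_mono) (intro sets.Un T_correct T_others)
  also have "\<dots> \<le> measure (gaussian n ?m s) (?T (w i) (- a * sqrt E))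
      + measure (gaussian n ?m s) (\<Union>v\<in>{1..M} - {w i}. ?T v ?\<theta>)"
    by (rule measure_Un_le[OF T_correct T_others])
  also have "measure (gaussian n ?m s) (\<Union>v\<in>{1..M} - {w i}. ?T v ?\<theta>)
      \<le> (\<Sum>v\<in>{1..M} - {w i}. measure (gaussian n ?m s) (?T v ?\<theta>))"
    by (rule measure_UNION_le) (use T_sets in auto)
  also have "\<dots> \<le> (\<Sum>v\<in>{1..M} - {w i}. exp (- ?\<theta>\<^sup>2 / (2 * s\<^sup>2)))"
    by (rule sum_mono) (use T_measure in auto)
  also have "\<dots> \<le> real M * exp (- ?\<theta>\<^sup>2 / (2 * s\<^sup>2))"
    using wi by (simp add: card_Diff_singleton mult_right_mono)
  also have "measure (gaussian n ?m s) (?T (w i) (- a * sqrt E)) \<le> exp (- (- a * sqrt E)\<^sup>2 / (2 * s\<^sup>2))"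
    by (rule T_measure) fact
  finally show ?thesis
    using assms by (simp add: power_mult_distrib)
qed

text \<open>For noise variance \<open>N0 / 2\<close> the denominators \<open>2 * s^2\<close> equal
  \<open>N0\<close>, and a bound valid for every tuple and user passes to the averages.\<close>

lemma pulse_code_ape_code:
  assumes "N0 > 0" "K \<ge> 1" "M \<ge> 1" "E > 0" "0 < a" "a < 1" "K * M \<le> n"
    and err: "exp (- (a\<^sup>2 * E) / N0) + real M * exp (- ((1 - a)\<^sup>2 * E) / N0) \<le> \<epsilon>"
  shows "ape_code N0 K n M E \<epsilon> (pulse_code M E) (threshold_decoder K M ((1 - a) * sqrt E))"
proof -
  let ?dec = "threshold_decoder K M ((1 - a) * sqrt E)"
  have dec: "?dec \<in> measurable (PiM {1..n} (\<lambda>_. borel)) (PiM {1..K} (\<lambda>_. count_space {1..M}))"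
    by (rule threshold_decoder_measurable) fact+
  have "user_error_prob N0 K n M (pulse_code M E) ?dec i \<le> \<epsilon>" if i: "i \<in> {1..K}" for i
  proof -
    have "(\<Sum>w\<in>messages K M. measure (gaussian n (superposition K (pulse_code M E) w) (sqrt (N0 / 2)))
        (error_set n ?dec i (w i))) \<le> (\<Sum>w\<in>messages K M. \<epsilon>)"
    proof (rule sum_mono)
      fix w assume w: "w \<in> messages K M"
      show "measure (gaussian n (superposition K (pulse_code M E) w) (sqrt (N0 / 2)))
          (error_set n ?dec i (w i)) \<le> \<epsilon>"
        using pulse_code_error_measure[of "sqrt (N0 / 2)" E a K M n w i] assms w i by simp
    qed
    then show ?thesis
      unfolding user_error_prob_eq[OF assms(1,3) dec i]
      using assms(3) by (simp add: card_messages pos_divide_le_eq mult.commute)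
  qed
  then have "(\<Sum>i=1..K. user_error_prob N0 K n M (pulse_code M E) ?dec i) \<le> (\<Sum>i=1..K. \<epsilon>)"
    by (intro sum_mono)
  then have "average_error_prob N0 K n M (pulse_code M E) ?dec \<le> \<epsilon>"
    using assms by (simp add: average_error_prob_def field_simps)
  then show ?thesis
    using assms dec pulse_code_energy by (simp add: ape_code_def)
qed

text \<open>The threshold sits near the full amplitude, so that \<open>M\<close> empty slots cost an
  energy only slightly above \<open>N0 * ln M\<close>. Once \<open>M\<close> is fixed by
  \<open>\<epsilon>\<close> and \<open>\<delta>\<close>, the blocks of all users fit into large
  blocklengths.\<close>

lemma achievable_orthogonal:
  assumes "N0 > 0" and k_pos: "\<And>n. n \<ge> 1 \<Longrightarrow> k n \<ge> 1"
    and small: "(\<lambda>n. real (k n)) \<in> o(\<lambda>n. real n)"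
  shows "achievable_by orthogonal_scheme k N0 (log 2 (exp 1) / N0)"
  unfolding achievable_by_def eps_achievable_by_def
proof (intro allI impI)
  fix \<epsilon> \<delta> :: real
  assume \<epsilon>: "0 < \<epsilon> \<and> \<epsilon> < 1" and \<delta>: "0 < \<delta>"
  define C where "C = log 2 (exp 1) / N0"
  have C: "C > 0" "C = 1 / (N0 * ln 2)"
    using assms by (auto simp: C_def log_def)
  \<comment> \<open>The bound \<open>1 / 2\<close> keeps \<open>1 - a\<close> positive; the other
    one makes the relative rate loss of at most \<open>3 * a\<close> cost no more than
    \<open>\<delta> / 2\<close>.\<close>
  define a where "a = min (1 / 2) (\<delta> / (6 * C))"
  have a: "0 < a" "a < 1" "6 * a * C \<le> \<delta>"
    using C(1) \<delta> by (auto simp: a_def min_def field_simps)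
  define p where "p = a\<^sup>2 / (1 - a) ^ 3"
  define q where "q = 1 / (1 - a)"
  have pq: "p > 0" "q > 1"
    using a by (auto simp: p_def q_def)
  \<comment> \<open>These are the two error terms for the energy chosen below: a missed pulse and a
    false alarm. The latter vanishes because \<open>q > 1\<close> beats the factor \<open>M\<close>
    of the union bound.\<close>
  have "(\<lambda>M. real M powr (- p) + real M powr (1 - q)) \<longlonglongrightarrow> 0 + 0"
    using pq by (intro tendsto_add tendsto_neg_powr filterlim_real_sequentially) auto
  then have "\<forall>\<^sub>F M in sequentially. real M powr (- p) + real M powr (1 - q) < \<epsilon>"
    using \<epsilon> by (intro order_tendstoD) auto
  then have "\<forall>\<^sub>F M in sequentially. real M powr (- p) + real M powr (1 - q) < \<epsilon> \<and> M \<ge> 2"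
    using eventually_ge_at_top[of "2::nat"] by eventually_elim simp
  then obtain M where M: "real M powr (- p) + real M powr (1 - q) < \<epsilon>" "M \<ge> 2"
    using eventually_happens'[OF sequentially_bot] by blast
  \<comment> \<open>Two of the three factors \<open>1 - a\<close> compensate for the lowered
    threshold, and the third leaves the false-alarm exponent strictly above
    \<open>ln M\<close>.\<close>
  define E where "E = N0 * ln (real M) / (1 - a) ^ 3"
  have E: "E > 0"
    using M assms a by (simp add: E_def)
  have "exp (- (a\<^sup>2 * E) / N0) = real M powr (- p)"
    using assms M by (simp add: E_def p_def powr_def field_simps)
  moreover have "real M * exp (- ((1 - a)\<^sup>2 * E) / N0) = real M powr (1 - q)"
  proof -
    have "(1 - a)\<^sup>2 * E / N0 = q * ln (real M)"
      using assms a by (simp add: E_def q_def power2_eq_square power3_eq_cube)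
    then show ?thesis
      using M by (simp add: powr_def exp_diff left_diff_distrib exp_minus field_simps)
  qed
  ultimately have err: "exp (- (a\<^sup>2 * E) / N0) + real M * exp (- ((1 - a)\<^sup>2 * E) / N0) \<le> \<epsilon>"
    using M by simp
  have "C - \<delta> < (1 - 3 * a) * C"
    using a \<delta> by (simp add: left_diff_distrib)
  also have "\<dots> \<le> (1 - a) ^ 3 * C"
    using Bernoulli_inequality[of "- a" 3] a C by (intro mult_right_mono) auto
  also have "\<dots> = log 2 (real M) / E"
    using assms M a by (simp add: C E_def log_def)
  finally have rate: "log 2 (real M) / E > C - \<delta>" .
  \<comment> \<open>The little-o condition with constant \<open>1 / M\<close> gives
    \<open>k n * M <= n\<close> eventually.\<close>
  have "\<forall>\<^sub>F n in sequentially. real (k n) \<le> 1 / real M * real n"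
    using landau_o.smallD[OF small, of "1 / real M"] M by simp
  then obtain n1 where n1: "\<And>n. n \<ge> n1 \<Longrightarrow> real (k n) \<le> 1 / real M * real n"
    by (auto simp: eventually_sequentially)
  show "\<exists>n0. \<forall>n\<ge>n0. \<exists>M E x dec. ape_code N0 (k n) n M E \<epsilon> x dec \<and>
      orthogonal_scheme (k n) n M x \<and> log 2 (exp 1) / N0 - \<delta> < log 2 (real M) / E"
  proof (rule exI[of _ "max 1 n1"], intro allI impI)
    fix n assume n: "n \<ge> max 1 n1"
    then have "real (k n * M) \<le> real n"
      using n1[of n] M by (simp add: field_simps)
    then have kM: "k n * M \<le> n"
      by (simp only: of_nat_le_iff)
    have "ape_code N0 (k n) n M E \<epsilon> (pulse_code M E) (threshold_decoder (k n) M ((1 - a) * sqrt E))"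
      by (rule pulse_code_ape_code) (use assms k_pos[of n] n M E a kM err in auto)
    then show "\<exists>M E x dec. ape_code N0 (k n) n M E \<epsilon> x dec \<and>
        orthogonal_scheme (k n) n M x \<and> log 2 (exp 1) / N0 - \<delta> < log 2 (real M) / E"
      using pulse_code_orthogonal rate unfolding C_def by blast
  qed
qed

subsection \<open>The capacity per unit-energy\<close>

text \<open>The threshold \<open>\<epsilon>0\<close> is uniform in the number of users, the
  blocklength and the number of messages. It comes from the energy lower bound with \<open>t\<close>
  large and \<open>\<epsilon> <= exp (- t)\<close>, which keeps the error term at most 1.\<close>

lemma energy_unbounded:
  assumes "N0 > 0" "Emax \<ge> 0"
  obtains \<epsilon>0 where "\<epsilon>0 > 0"
    and "\<And>K n M E \<epsilon> x dec. ape_code N0 K n M E \<epsilon> x dec \<Longrightarrow> K \<ge> 1 \<Longrightarrow> M \<ge> 2 \<Longrightarrow> \<epsilon> \<le> \<epsilon>0 \<Longrightarrow> E > Emax"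
proof
  \<comment> \<open>With \<open>\<epsilon> <= 1 / 2\<close> the bound reads
    \<open>t / 2 <= 4 * E / N0 + 1\<close>; this \<open>t\<close> makes the left side
    \<open>4 * Emax / N0 + 2\<close>.\<close>
  define t where "t = 8 * Emax / N0 + 4"
  have t: "t \<ge> 0"
    using assms by (simp add: t_def)
  show "min (1 / 2) (exp (- t)) > 0"
    by simp
  fix K n M E \<epsilon> x dec
  assume code: "ape_code N0 K n M E \<epsilon> x dec" and "K \<ge> 1" "M \<ge> 2" and \<epsilon>: "\<epsilon> \<le> min (1 / 2) (exp (- t))"
  then have bound: "t * (1 - \<epsilon>) \<le> 4 * E / N0 + (exp t - 1) * \<epsilon>"
    using energy_lower_bound[OF assms(1) _ _ code t] by simp
  have "(exp t - 1) * \<epsilon> \<le> (exp t - 1) * exp (- t)"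
    using \<epsilon> t by (intro mult_left_mono) auto
  also have "\<dots> \<le> 1"
    by (simp add: left_diff_distrib exp_minus)
  finally have "t * (1 - \<epsilon>) \<le> 4 * E / N0 + 1"
    using bound by simp
  moreover have "t * (1 / 2) \<le> t * (1 - \<epsilon>)"
    using \<epsilon> t by (intro mult_left_mono) auto
  ultimately have "4 * Emax / N0 < 4 * E / N0"
    by (simp add: t_def)
  then show "E > Emax"
    using assms by (simp add: divide_less_cancel)
qed

text \<open>The contradiction shared by both converses: \<open>Emax\<close> bounds the energy for
  every error level up to \<open>\<kappa>\<close>, so \<open>\<epsilon>\<close> can be shrunk until
  the energy must exceed \<open>Emax\<close>.\<close>

lemma not_achievable:
  assumes "N0 > 0" and k_pos: "\<And>n. n \<ge> 1 \<Longrightarrow> k n \<ge> 1"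
    and "\<delta> > 0" "R \<ge> \<delta>" "\<kappa> > 0"
    and energy: "\<And>n M E \<epsilon> x dec. n \<ge> 1 \<Longrightarrow> n \<ge> nmin \<Longrightarrow> \<epsilon> \<le> \<kappa> \<Longrightarrow>
      ape_code N0 (k n) n M E \<epsilon> x dec \<Longrightarrow> ln (real M) > (R - \<delta>) * ln 2 * E \<Longrightarrow> E \<le> Emax"
  shows "\<not> achievable_by any_scheme k N0 R"
proof
  assume achievable: "achievable_by any_scheme k N0 R"
  obtain \<epsilon>0 where \<epsilon>0: "\<epsilon>0 > 0" and unbounded: "\<And>K n M E \<epsilon> x dec. ape_code N0 K n M E \<epsilon> x dec \<Longrightarrow>
      K \<ge> 1 \<Longrightarrow> M \<ge> 2 \<Longrightarrow> \<epsilon> \<le> \<epsilon>0 \<Longrightarrow> E > max Emax 0"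
    using energy_unbounded[OF assms(1), of "max Emax 0"] by auto
  define \<epsilon> where "\<epsilon> = min (1 / 2) (min \<epsilon>0 \<kappa>)"
  have "0 < \<epsilon>" "\<epsilon> < 1"
    using assms \<epsilon>0 by (auto simp: \<epsilon>_def)
  then have "eps_achievable_by any_scheme k N0 \<epsilon> R"
    using achievable by (simp add: achievable_by_def)
  then obtain n0 where n0: "\<And>n. n \<ge> n0 \<Longrightarrow> \<exists>M E x dec.
      ape_code N0 (k n) n M E \<epsilon> x dec \<and> log 2 (real M) / E > R - \<delta>"
    using \<open>\<delta> > 0\<close> unfolding eps_achievable_by_def any_scheme_def by meson
  define n where "n = max 1 (max n0 nmin)"
  have n: "n \<ge> 1" "n \<ge> n0" "n \<ge> nmin"
    by (auto simp: n_def)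
  obtain M E x dec where code: "ape_code N0 (k n) n M E \<epsilon> x dec" and rate: "log 2 (real M) / E > R - \<delta>"
    using n0[OF n(2)] by blast
  have E: "E > 0" and M: "M \<ge> 1"
    using code by (auto simp: ape_code_def)
  have ln_M: "ln (real M) > (R - \<delta>) * ln 2 * E"
    using rate E by (simp add: log_def field_simps)
  \<comment> \<open>A nonnegative target rate excludes the code with a single message, to which the
    energy lower bound does not apply.\<close>
  have "0 \<le> (R - \<delta>) * ln 2 * E"
    using assms E by (intro mult_nonneg_nonneg) auto
  then have "ln (real M) > 0"
    using ln_M by linarith
  then have "M \<ge> 2"
    using M by (cases "M = 1") auto
  then have "E > max Emax 0"
    using unbounded[OF code k_pos[OF n(1)]] by (simp add: \<epsilon>_def)
  moreover have "E \<le> Emax"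
    using energy[OF n(1,3) _ code ln_M] by (simp add: \<epsilon>_def)
  ultimately show False by simp
qed

text \<open>Applying \<open>ln (1 + u) <= u\<close> to the sum-rate bound removes \<open>n\<close>
  and \<open>k n\<close> and leaves \<open>ln 2 + E / N0\<close>. A rate above the claimed value
  makes the left side grow faster in \<open>E\<close>, so \<open>E\<close> stays bounded.\<close>

lemma rate_le_single_user_bound:
  assumes "N0 > 0" and k_pos: "\<And>n. n \<ge> 1 \<Longrightarrow> k n \<ge> 1"
    and achievable: "achievable_by any_scheme k N0 R"
  shows "R \<le> log 2 (exp 1) / N0"
proof (rule ccontr)
  define C where "C = log 2 (exp 1) / N0"
  assume "\<not> R \<le> log 2 (exp 1) / N0"
  then have R: "R > C"
    by (simp add: C_def)
  have C: "C > 0" "C * ln 2 = 1 / N0"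
    using assms by (auto simp: C_def log_def)
  define \<delta> where "\<delta> = (R - C) / 2"
  define \<rho> where "\<rho> = (R - \<delta>) * ln 2"
  have "C * ln 2 < \<rho>"
    unfolding \<rho>_def using R by (intro mult_strict_right_mono) (auto simp: \<delta>_def field_simps)
  then have \<rho>: "\<rho> > 1 / N0" "\<rho> > 0"
    using C assms by (auto intro: less_trans[of 0 "1 / N0"])
  \<comment> \<open>Chosen so that \<open>(1 - \<kappa>) * \<rho>\<close> is the midpoint of
    \<open>\<rho>\<close> and \<open>1 / N0\<close>, exceeding the latter by
    \<open>\<eta>\<close>.\<close>
  define \<kappa> where "\<kappa> = (\<rho> - 1 / N0) / (2 * \<rho>)"
  define \<eta> where "\<eta> = (\<rho> - 1 / N0) / 2"
  have \<eta>: "\<eta> > 0" "(1 - \<kappa>) * \<rho> = \<eta> + 1 / N0" and \<kappa>: "\<kappa> > 0" "\<kappa> < 1"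
    using \<rho> assms by (auto simp: \<eta>_def \<kappa>_def field_simps)
  have "\<not> achievable_by any_scheme k N0 R"
  proof (rule not_achievable[where \<delta> = \<delta> and \<kappa> = \<kappa> and nmin = 1 and Emax = "ln 2 / \<eta>"])
    fix n M E \<epsilon> x dec
    assume n: "n \<ge> (1::nat)" and \<epsilon>: "\<epsilon> \<le> \<kappa>" and code: "ape_code N0 (k n) n M E \<epsilon> x dec"
      and ln_M: "ln (real M) > (R - \<delta>) * ln 2 * E"
    have E: "E > 0"
      using code by (simp add: ape_code_def)
    have k: "real (k n) > 0" "real n > 0"
      using k_pos[OF n] n by auto
    have "(1 - \<kappa>) * (\<rho> * E) \<le> (1 - \<epsilon>) * ln (real M)"
      using \<epsilon> \<kappa> ln_M \<rho> E by (intro mult_mono) (auto simp: \<rho>_def)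
    also have "\<dots> \<le> ln 2 + real n / (2 * real (k n)) * ln (1 + 2 * real (k n) * E / (real n * N0))"
      by (rule sum_rate_bound[OF assms(1) n k_pos[OF n] code])
    also have "\<dots> \<le> ln 2 + real n / (2 * real (k n)) * (2 * real (k n) * E / (real n * N0))"
      using k E assms by (intro add_left_mono mult_left_mono ln_add_one_self_le_self) auto
    also have "\<dots> = ln 2 + E / N0"
      using k by simp
    finally have "\<eta> * E \<le> ln 2"
      using \<eta>(2) by (simp add: mult.assoc[symmetric] distrib_right)
    then show "E \<le> ln 2 / \<eta>"
      using \<eta> by (simp add: field_simps)
  qed (use assms R C \<kappa> in \<open>auto simp: \<delta>_def field_simps\<close>)
  then show False
    using achievable by contradiction
qed

text \<open>From \<open>1 + u <= (1 + sqrt u)^2\<close>; growth below linear is what the second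
  converse requires.\<close>

lemma ln_add_one_le_sqrt:
  fixes u :: real
  assumes "u \<ge> 0"
  shows "ln (1 + u) \<le> 2 * sqrt u"
proof -
  have "1 + u \<le> (1 + sqrt u)\<^sup>2"
    using assms by (simp add: power2_sum)
  also have "\<dots> \<le> (exp (sqrt u))\<^sup>2"
    using assms by (intro power_mono exp_ge_add_one_self) auto
  also have "\<dots> = exp (2 * sqrt u)"
    by (simp add: exp_double)
  finally have "ln (1 + u) \<le> ln (exp (2 * sqrt u))"
    using assms by (subst ln_le_cancel_iff) auto
  then show ?thesis by simp
qed

text \<open>With at least \<open>c * n\<close> users the sum-rate bound grows only like
  \<open>sqrt E\<close>, while a positive rate needs growth linear in \<open>E\<close>; hence
  \<open>E\<close> is bounded.\<close>

lemma rate_le_zero: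
  assumes "N0 > 0" and k_pos: "\<And>n. n \<ge> 1 \<Longrightarrow> k n \<ge> 1"
    and large: "(\<lambda>n. real (k n)) \<in> \<Omega>(\<lambda>n. real n)"
    and achievable: "achievable_by any_scheme k N0 R"
  shows "R \<le> 0"
proof (rule ccontr)
  assume "\<not> R \<le> 0"
  then have R: "R > 0" by simp
  obtain c where c: "c > 0" and "\<forall>\<^sub>F n in sequentially. norm (real (k n)) \<ge> c * norm (real n)"
    using landau_omega.bigE[OF large] by blast
  then obtain nmin where nmin: "\<And>n. n \<ge> nmin \<Longrightarrow> real (k n) \<ge> c * real n"
    by (auto simp: eventually_sequentially)
  define \<rho> where "\<rho> = R / 2 * ln 2"
  define b where "b = 2 / (c * N0)"
  have \<rho>: "\<rho> > 0" and b: "b > 0"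
    using R c assms by (auto simp: \<rho>_def b_def)
  have "\<not> achievable_by any_scheme k N0 R"
  proof (rule not_achievable[where \<delta> = "R / 2" and \<kappa> = "1 / 2" and nmin = nmin and Emax = "4 * (ln 2 + b / \<rho>) / \<rho>"])
    fix n M E \<epsilon> x dec
    assume n: "n \<ge> (1::nat)" "n \<ge> nmin" and \<epsilon>: "\<epsilon> \<le> 1 / 2" and code: "ape_code N0 (k n) n M E \<epsilon> x dec"
      and ln_M: "ln (real M) > (R - R / 2) * ln 2 * E"
    have E: "E > 0"
      using code by (simp add: ape_code_def)
    have k: "real (k n) > 0" "real n > 0"
      using k_pos[OF n(1)] n by auto
    define u where "u = 2 * real (k n) * E / (real n * N0)"
    have u: "u \<ge> 0"
      using k E assms by (simp add: u_def)
    have "1 / 2 * (\<rho> * E) \<le> (1 - \<epsilon>) * ln (real M)"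
      using \<epsilon> ln_M \<rho> E by (intro mult_mono) (auto simp: \<rho>_def)
    also have "\<dots> \<le> ln 2 + real n / (2 * real (k n)) * ln (1 + u)"
      unfolding u_def by (rule sum_rate_bound[OF assms(1) n(1) k_pos[OF n(1)] code])
    also have "\<dots> \<le> ln 2 + real n / (2 * real (k n)) * (2 * sqrt u)"
      using k u by (intro add_left_mono mult_left_mono ln_add_one_le_sqrt) auto
    also have "real n / (2 * real (k n)) * (2 * sqrt u) = sqrt ((real n / real (k n))\<^sup>2 * u)"
      using k by (simp add: real_sqrt_mult)
    also have "\<dots> \<le> sqrt (b * E)"
    proof (rule real_sqrt_le_mono)
      have "(real n / real (k n))\<^sup>2 * u = real n / real (k n) * (2 * E / N0)"
        using k by (simp add: u_def power2_eq_square field_simps)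
      also have "\<dots> \<le> 1 / c * (2 * E / N0)"
        using nmin[OF n(2)] k c E assms by (intro mult_right_mono) (auto simp: field_simps)
      also have "\<dots> = b * E"
        by (simp add: b_def)
      finally show "(real n / real (k n))\<^sup>2 * u \<le> b * E" .
    qed
    \<comment> \<open>AM-GM, weighted so that the linear term absorbs only half of
      \<open>\<rho> * E / 2\<close>.\<close>
    also have "sqrt (b * E) \<le> \<rho> * E / 4 + b / \<rho>"
    proof (rule real_le_lsqrt)
      have "(\<rho> * E / 4 + b / \<rho>)\<^sup>2 - b * E = (\<rho> * E / 4 - b / \<rho>)\<^sup>2"
        using \<rho> by (simp add: power2_eq_square field_simps)
      then show "b * E \<le> (\<rho> * E / 4 + b / \<rho>)\<^sup>2"
        using zero_le_power2[of "\<rho> * E / 4 - b / \<rho>"] by linarith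
    qed (use \<rho> b E in auto)
    finally have "1 / 2 * (\<rho> * E) \<le> ln 2 + (\<rho> * E / 4 + b / \<rho>)"
      by simp
    then have "\<rho> * E / 4 \<le> ln 2 + b / \<rho>"
      by linarith
    then show "E \<le> 4 * (ln 2 + b / \<rho>) / \<rho>"
      using \<rho> by (simp add: field_simps)
  qed (use assms R in auto)
  then show False
    using achievable by contradiction
qed

section \<open>Rate zero and the capacity values\<close>

text \<open>A single message has rate 0 and is decoded without error by a constant decoder; the
  energy budget 1 only has to be positive.\<close>

lemma achievable_zero:
  assumes "N0 > 0"
  shows "achievable_by any_scheme k N0 0"
  unfolding achievable_by_def eps_achievable_by_def
proof (intro allI impI, rule exI[of _ 1], intro allI impI)
  fix \<epsilon> \<delta> :: real and n :: nat
  assume \<epsilon>: "0 < \<epsilon> \<and> \<epsilon> < 1" and "0 < \<delta>" and n: "1 \<le> n"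
  let ?dec = "\<lambda>y. \<lambda>i\<in>{1..k n}. 1::nat"
  have dec: "?dec \<in> measurable (PiM {1..n} (\<lambda>_. borel)) (PiM {1..k n} (\<lambda>_. count_space {1..1}))"
    by (intro measurable_restrict measurable_const) simp
  have "user_error_prob N0 (k n) n 1 (\<lambda>_ _ _. 0) ?dec i = 0" if i: "i \<in> {1..k n}" for i
  proof -
    have "error_set n ?dec i (w i) = {}" if "w \<in> messages (k n) 1" for w
      using messages_mem[OF that i] i by (simp add: error_set_def)
    then show ?thesis
      by (subst user_error_prob_eq[OF assms order_refl dec i]) simp
  qed
  then have "ape_code N0 (k n) n 1 1 \<epsilon> (\<lambda>_ _ _. 0) ?dec"
    using dec \<epsilon> by (simp add: ape_code_def average_error_prob_def)
  then show "\<exists>M E x dec. ape_code N0 (k n) n M E \<epsilon> x dec \<and>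
      any_scheme (k n) n M x \<and> 0 - \<delta> < log 2 (real M) / E"
    using \<open>0 < \<delta>\<close> by (intro exI[of _ 1] exI conjI) (auto simp: any_scheme_def)
qed

lemma achievable_any_scheme:
  "achievable_by S k N0 R \<Longrightarrow> achievable_by any_scheme k N0 R"
  unfolding achievable_by_def eps_achievable_by_def any_scheme_def by meson

lemma capacity_eqI:
  assumes "achievable_by any_scheme k N0 C"
    and "\<And>R. achievable_by any_scheme k N0 R \<Longrightarrow> R \<le> C"
  shows "capacity_APE k N0 = ereal C"
  unfolding capacity_APE_def using assms by (intro Sup_eqI) auto

theorem theorem3:
  fixes k :: "nat \<Rightarrow> nat" and N0 :: real
  assumes "N0 > 0"
    and "\<And>n. n \<ge> 1 \<Longrightarrow> k n \<ge> 1"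
  shows
    "((\<lambda>n. real (k n)) \<in> o(\<lambda>n. real n) \<longrightarrow>
        capacity_APE k N0 = ereal (log 2 (exp 1) / N0) \<and>
        achievable_by orthogonal_scheme k N0 (log 2 (exp 1) / N0)) \<and>
     ((\<lambda>n. real (k n)) \<in> \<Omega>(\<lambda>n. real n) \<longrightarrow>
        capacity_APE k N0 = 0)"
proof (intro conjI impI)
  assume small: "(\<lambda>n. real (k n)) \<in> o(\<lambda>n. real n)"
  show achievable: "achievable_by orthogonal_scheme k N0 (log 2 (exp 1) / N0)"
    by (rule achievable_orthogonal[OF assms small])
  \<comment> \<open>The orthogonal scheme is in particular an admissible scheme, so it also provides
    the lower bound on the capacity.\<close>
  show "capacity_APE k N0 = ereal (log 2 (exp 1) / N0)"
    by (rule capacity_eqI[OF achievable_any_scheme[OF achievable]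
        rate_le_single_user_bound[OF assms]])
next
  assume large: "(\<lambda>n. real (k n)) \<in> \<Omega>(\<lambda>n. real n)"
  show "capacity_APE k N0 = 0"
    using capacity_eqI[OF achievable_zero[OF assms(1)] rate_le_zero[OF assms large]]
    by (simp add: zero_ereal_def)
qed

end
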